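(* Let $k^*(P_\ell,2)$ be as defined in the context. Then, as $\ell\to\infty$, \[ k^*(P_\ell,2)=\Omega(\ell^{2.01}) \quad\text{and}\quad k^*(P_\ell,2)=O(\ell^{2.59}), \] i.e.\ there are constants $C_1,C_2>0$ with $C_1\ell^{2.01}\le k^*(P_\ell,2)\le C_2\ell^{2.59}$ for all sufficiently large $\ell$.
   Context: Let $r\ge 2$ be an integer and $F_1,\dots,F_r$ forests. For a positive integer $k$, the $(F_1,\dots,F_r)$-avoidance game with tree size restriction $k$ is played by Builder and Painter on a vertex-colored graph (the board), initially empty. In each step Builder adds one new vertex together with edges from some previously present vertices to it, subject to the condition that the board always remains a forest all of whose components have at most $k$ vertices; Painter then immediately and irrevocably colors the new vertex with one of the colors $1,\dots,r$. Painter loses as soon as, for some $s\in\{1,\dots,r\}$, the board contains a copy of $F_s$ (a subgraph isomorphic to $F_s$) all of whose vertices have color $s$. Builder has a winning strategy if he can force this within finitely many steps. $k^*(F_1,\dots,F_r)$ is the smallest $k$ for which Builder has a winning strategy (such $k$ exists). For a forest $F$, $k^*(F,r):=k^*(F,\dots,F)$ ($r$ copies). $P_\ell$ denotes the path on $\ell$ vertices; thus $k^*(P_\ell,2)=k^*(P_\ell,P_\ell)$ with two colors. *)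

theory Defs
  imports Complex_Main "HOL-Library.Landau_Symbols"
begin

text \<open>Simple graphs are pairs of a vertex set and a set of two-element vertex sets.\<close>

type_synonym 'a graph = "'a set \<times> 'a set set"

abbreviation verts :: "'a graph \<Rightarrow> 'a set" where
  "verts G \<equiv> fst G"

abbreviation edges :: "'a graph \<Rightarrow> 'a set set" where
  "edges G \<equiv> snd G"

definition simple_graph :: "'a graph \<Rightarrow> bool" where
  "simple_graph G \<longleftrightarrow> finite (verts G) \<and> (\<forall>e\<in>edges G. e \<subseteq> verts G \<and> card e = 2)"

definition subgraph :: "'a graph \<Rightarrow> 'a graph \<Rightarrow> bool" where
  "subgraph H G \<longleftrightarrow> simple_graph H \<and> verts H \<subseteq> verts G \<and> edges H \<subseteq> edges G"

definition graph_iso :: "'b graph \<Rightarrow> 'a graph \<Rightarrow> bool" where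
  "graph_iso F H \<longleftrightarrow> (\<exists>f. bij_betw f (verts F) (verts H) \<and> edges H = (\<lambda>e. f ` e) ` edges F)"

definition adjacency :: "'a graph \<Rightarrow> 'a rel" where
  "adjacency G = {(u, v). u \<noteq> v \<and> {u, v} \<in> edges G}"

definition components :: "'a graph \<Rightarrow> 'a set set" where
  "components G = {{w. (v, w) \<in> (adjacency G)\<^sup>*} |v. v \<in> verts G}"

definition is_cycle :: "'a graph \<Rightarrow> 'a list \<Rightarrow> bool" where
  "is_cycle G c \<longleftrightarrow> length c \<ge> 3 \<and> distinct c \<and>
     (\<forall>i<length c. {c ! i, c ! (Suc i mod length c)} \<in> edges G)"

definition forest :: "'a graph \<Rightarrow> bool" where
  "forest G \<longleftrightarrow> simple_graph G \<and> (\<nexists>c. is_cycle G c)"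

definition path_graph :: "nat \<Rightarrow> nat graph" where
  "path_graph l = ({..<l}, {{i, Suc i} |i. Suc i < l})"

text \<open>
  A position of the game is a board on natural-number vertices together with a vertex
  coloring; the coloring is a total function whose values outside the board play no role.
  The forests are given as a family \<open>F\<close>, of which only \<open>F 1, \<dots>, F r\<close> matter.
\<close>

definition painter_lost ::
  "nat \<Rightarrow> (nat \<Rightarrow> 'b graph) \<Rightarrow> nat graph \<Rightarrow> (nat \<Rightarrow> nat) \<Rightarrow> bool" where
  "painter_lost r F G col \<longleftrightarrow>
     (\<exists>s\<in>{1..r}. \<exists>H. subgraph H G \<and> graph_iso (F s) H \<and> (\<forall>v\<in>verts H. col v = s))"

definition add_vertex :: "nat graph \<Rightarrow> nat \<Rightarrow> nat set \<Rightarrow> nat graph" where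
  "add_vertex G v N = (insert v (verts G), edges G \<union> {{u, v} |u. u \<in> N})"

definition legal_move :: "nat \<Rightarrow> nat graph \<Rightarrow> nat \<Rightarrow> nat set \<Rightarrow> bool" where
  "legal_move k G v N \<longleftrightarrow> v \<notin> verts G \<and> N \<subseteq> verts G \<and>
     forest (add_vertex G v N) \<and> (\<forall>C\<in>components (add_vertex G v N). card C \<le> k)"

text \<open>\<open>builder_forces r F k n G col\<close>: from the given position, Builder can force Painter
  to lose within at most \<open>n\<close> further steps.\<close>

primrec builder_forces ::
  "nat \<Rightarrow> (nat \<Rightarrow> 'b graph) \<Rightarrow> nat \<Rightarrow> nat \<Rightarrow> nat graph \<Rightarrow> (nat \<Rightarrow> nat) \<Rightarrow> bool" where
  "builder_forces r F k 0 G col \<longleftrightarrow> painter_lost r F G col"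
| "builder_forces r F k (Suc n) G col \<longleftrightarrow> painter_lost r F G col \<or>
     (\<exists>v N. legal_move k G v N \<and>
        (\<forall>c\<in>{1..r}. builder_forces r F k n (add_vertex G v N) (col(v := c))))"

text \<open>The initial coloring below is arbitrary, since the initial board is empty.\<close>

definition builder_wins :: "nat \<Rightarrow> (nat \<Rightarrow> 'b graph) \<Rightarrow> nat \<Rightarrow> bool" where
  "builder_wins r F k \<longleftrightarrow> (\<exists>n. builder_forces r F k n ({}, {}) (\<lambda>_. 0))"

definition k_star :: "nat \<Rightarrow> (nat \<Rightarrow> 'b graph) \<Rightarrow> nat" where
  "k_star r F = (LEAST k. k > 0 \<and> builder_wins r F k)"

definition k_star_diag :: "'b graph \<Rightarrow> nat \<Rightarrow> nat" where
  "k_star_diag F r = k_star r (\<lambda>_. F)"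

end

theory Submission
  imports Defs
begin

text \<open>
  Both bounds come from accounting how many vertices a component must have before it contains
  a monochromatic path of a given length.

  For the lower bound, let \<open>g\<close> and \<open>h\<close> vanish at 0 and be such that for all \<open>a1, a2, b1, b2\<close> one of
  \<open>g (a1 + a2 + 1)\<close>, \<open>h (b1 + b2 + 1)\<close> is at most \<open>1 + g a1 + g a2 + h b1 + h b2\<close>. Then Painter can
  keep every component that contains a path on \<open>a\<close> vertices in color 1 (color 2) at size at least
  \<open>g a\<close> (\<open>h a\<close>): if both colors violated this at a new vertex, the at most four pieces that it
  joins would lie in distinct components of the old forest. The greedy strategy is \<open>g a = c * a\<close>,
  \<open>h b = b\<close>, which gives only a quadratic bound. Such pairs can be multiplied, so a single
  finite one beating the greedy bound improves the exponent; one of dimensions 88 and 6 and value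
  547 has \<open>ln 547 / ln (88 * 6) > 1.005\<close>.

  For the upper bound, Builder stockpiles copies of the paths that Painter has conceded so far. If
  these are the lengths below \<open>a\<close> in color 1 and below \<open>b\<close> in color 2, he joins suitable
  pieces by a new vertex, which forces a path on \<open>a\<close> vertices in color 1 or on \<open>b\<close> vertices in color 2.
  Halving \<open>a\<close>, and splitting \<open>b\<close> at the length reached in color 2 when \<open>a div 2\<close> was conceded,
  shows that components of size \<open>b * 3 ^ \<lfloor>log 2 a\<rfloor>\<close> suffice.
\<close>

section \<open>Connectivity when a vertex is added to a forest\<close>

definition comp_of :: "'a graph \<Rightarrow> 'a \<Rightarrow> 'a set" where
  "comp_of G v = {w. (v, w) \<in> (adjacency G)\<^sup>*}"

lemma components_eq: "components G = comp_of G ` verts G"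
  by (auto simp: components_def comp_of_def)

lemma sym_adjacency: "sym (adjacency G)"
  by (auto simp: sym_def adjacency_def insert_commute)

lemma comp_of_self [simp]: "v \<in> comp_of G v"
  by (simp add: comp_of_def)

lemma comp_of_sym: "w \<in> comp_of G v \<Longrightarrow> v \<in> comp_of G w"
  using symD[OF sym_rtrancl[OF sym_adjacency]] unfolding comp_of_def by fast

lemma comp_of_trans: "w \<in> comp_of G v \<Longrightarrow> x \<in> comp_of G w \<Longrightarrow> x \<in> comp_of G v"
  by (auto simp: comp_of_def)

lemma comp_of_eq: "w \<in> comp_of G v \<Longrightarrow> comp_of G w = comp_of G v"
  by (blast intro: comp_of_trans comp_of_sym)

lemma comp_of_disjoint: "u \<notin> comp_of G v \<Longrightarrow> comp_of G u \<inter> comp_of G v = {}"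
  by (blast intro: comp_of_trans comp_of_sym)

lemma adjacency_verts: "simple_graph G \<Longrightarrow> (x, y) \<in> adjacency G \<Longrightarrow> x \<in> verts G \<and> y \<in> verts G"
  by (auto simp: adjacency_def simple_graph_def)

lemma edge_adjacency: "simple_graph G \<Longrightarrow> {x, y} \<in> edges G \<Longrightarrow> (x, y) \<in> adjacency G"
  unfolding adjacency_def simple_graph_def by fastforce

lemma comp_of_verts: "simple_graph G \<Longrightarrow> v \<in> verts G \<Longrightarrow> comp_of G v \<subseteq> verts G"
proof
  fix w assume G: "simple_graph G" "v \<in> verts G" "w \<in> comp_of G v"
  from G(3) have "(v, w) \<in> (adjacency G)\<^sup>*" by (simp add: comp_of_def)
  then show "w \<in> verts G" using G(1,2) by induction (auto dest: adjacency_verts)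
qed

lemma finite_comp_of: "simple_graph G \<Longrightarrow> v \<in> verts G \<Longrightarrow> finite (comp_of G v)"
  using comp_of_verts finite_subset by (metis simple_graph_def)

section \<open>Walks, simple paths and connectivity\<close>

abbreviation walk :: "'a graph \<Rightarrow> 'a list \<Rightarrow> bool" where
  "walk G \<equiv> successively (\<lambda>x y. {x, y} \<in> edges G)"

lemma walk_connected:
  assumes "simple_graph G"
    and "walk G p" "x \<in> set p" "y \<in> set p"
  shows "y \<in> comp_of G x"
proof -
  have hd: "walk G p \<Longrightarrow> x \<in> set p \<Longrightarrow> x \<in> comp_of G (hd p)" for x
  proof (induction p arbitrary: x)
    case (Cons z p)
    show ?case
    proof (cases "x = z")
      case False
      then have p: "x \<in> set p" "p \<noteq> []" using Cons.prems by auto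
      then have "{z, hd p} \<in> edges G" "walk G p" using Cons.prems by (auto simp: successively_Cons)
      then have "x \<in> comp_of G (hd p)" "hd p \<in> comp_of G z"
        using Cons.IH p edge_adjacency[OF assms(1)] by (auto simp: comp_of_def)
      then show ?thesis using comp_of_trans[of "hd p" G z x] by simp
    qed simp
  qed simp
  have "x \<in> comp_of G (hd p)" "y \<in> comp_of G (hd p)" using hd assms by auto
  then show "y \<in> comp_of G x" using comp_of_eq[of x G "hd p"] by simp
qed

lemma connected_simple_path:
  assumes "w \<in> comp_of G u"
  shows "\<exists>p. p \<noteq> [] \<and> distinct p \<and> hd p = u \<and> last p = w \<and> walk G p"
proof -
  from assms have "(u, w) \<in> (adjacency G)\<^sup>*" by (simp add: comp_of_def)
  then show ?thesis
  proof induction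
    case base
    show ?case by (rule exI[of _ "[u]"]) simp
  next
    case (step y z)
    then obtain p where p: "p \<noteq> []" "distinct p" "hd p = u" "last p = y" "walk G p" by blast
    show ?case
    proof (cases "z \<in> set p")
      case True
      \<comment> \<open>The walk returns to a vertex of \<open>p\<close>; cutting \<open>p\<close>
        there keeps the path simple.\<close>
      then obtain q r where "p = q @ z # r" by (meson split_list)
      then show ?thesis using p
        by (intro exI[of _ "q @ [z]"]) (auto simp: successively_append_iff hd_append split: if_splits)
    next
      case False
      then show ?thesis using p step(2)
        by (intro exI[of _ "p @ [z]"]) (auto simp: successively_append_iff adjacency_def)
    qed
  qed
qed

section \<open>The effect of one move on components and acyclicity\<close>

context
  fixes G :: "nat graph" and v :: nat and N :: "nat set"
  assumes G: "simple_graph G" and v: "v \<notin> verts G" and N: "N \<subseteq> verts G"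
begin

lemma simple_add_vertex: "simple_graph (add_vertex G v N)"
  using G v N by (auto simp: simple_graph_def add_vertex_def card_insert_if)

lemma edges_add_vertex: "{x, y} \<in> edges (add_vertex G v N) \<longleftrightarrow>
    {x, y} \<in> edges G \<or> x = v \<and> y \<in> N \<or> y = v \<and> x \<in> N"
  by (auto simp: add_vertex_def doubleton_eq_iff)

lemma adjacency_add_vertex: "(x, y) \<in> adjacency (add_vertex G v N) \<longleftrightarrow>
    (x, y) \<in> adjacency G \<or> x = v \<and> y \<in> N \<or> y = v \<and> x \<in> N"
  using v N unfolding adjacency_def mem_Collect_eq case_prod_conv edges_add_vertex by auto

lemma comp_of_mono: "comp_of G u \<subseteq> comp_of (add_vertex G v N) u"
proof -
  have "(adjacency G)\<^sup>* \<subseteq> (adjacency (add_vertex G v N))\<^sup>*"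
    by (rule rtrancl_mono) (auto simp: adjacency_add_vertex)
  then show ?thesis by (auto simp: comp_of_def)
qed

lemma comp_of_new: "comp_of (add_vertex G v N) v = insert v (\<Union>u\<in>N. comp_of G u)" (is "?L = ?R")
proof
  show "?L \<subseteq> ?R"
  proof
    fix w assume "w \<in> ?L"
    then have "(v, w) \<in> (adjacency (add_vertex G v N))\<^sup>*" by (simp add: comp_of_def)
    then show "w \<in> ?R"
    proof induction
      case (step y z)
      from step(2) consider "(y, z) \<in> adjacency G" | "y = v" "z \<in> N" | "z = v"
        by (auto simp: adjacency_add_vertex)
      then show ?case
      proof cases
        case 1
        then have "y \<noteq> v" using adjacency_verts[OF G] v by blast
        then obtain u where "u \<in> N" "y \<in> comp_of G u" using step by blast
        then have "z \<in> comp_of G u" using 1 by (auto simp: comp_of_def)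
        then show ?thesis using \<open>u \<in> N\<close> by blast
      qed (auto intro: comp_of_self)
    qed simp
  qed
  have "comp_of G u \<subseteq> ?L" if "u \<in> N" for u
  proof -
    have "u \<in> ?L" using that by (auto simp: comp_of_def adjacency_add_vertex)
    then show ?thesis using comp_of_mono[of u] comp_of_eq[of u "add_vertex G v N" v] by simp
  qed
  then show "?R \<subseteq> ?L" by auto
qed

lemma comp_of_old:
  assumes "w \<in> verts G" "comp_of G w \<inter> N = {}"
  shows "comp_of (add_vertex G v N) w = comp_of G w"
proof
  show "comp_of (add_vertex G v N) w \<subseteq> comp_of G w"
  proof
    fix x assume "x \<in> comp_of (add_vertex G v N) w"
    then have "(w, x) \<in> (adjacency (add_vertex G v N))\<^sup>*" by (simp add: comp_of_def)
    then show "x \<in> comp_of G w"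
    proof induction
      case (step y z)
      have "y \<notin> N" "y \<noteq> v" using assms step comp_of_verts[OF G] v by blast+
      then have "(y, z) \<in> adjacency G" using step(2) by (auto simp: adjacency_add_vertex)
      then show ?case using step by (auto simp: comp_of_def)
    qed simp
  qed
qed (rule comp_of_mono)

lemma components_add_vertex:
  "components (add_vertex G v N) =
     insert (insert v (\<Union>u\<in>N. comp_of G u)) {C \<in> components G. C \<inter> N = {}}" (is "?L = insert ?C ?R")
proof
  show "?L \<subseteq> insert ?C ?R"
  proof
    fix D assume "D \<in> ?L"
    then obtain w where w: "w = v \<or> w \<in> verts G" "D = comp_of (add_vertex G v N) w"
      by (auto simp: components_eq add_vertex_def)
    show "D \<in> insert ?C ?R"
    proof (cases "w = v")
      case True then show ?thesis using w comp_of_new by simp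
    next
      case False
      show ?thesis
      proof (cases "comp_of G w \<inter> N = {}")
        case True
        then show ?thesis using False w comp_of_old by (auto simp: components_eq)
      next
        case False
        then obtain u where "u \<in> N" "u \<in> comp_of G w" by blast
        then have "w \<in> comp_of (add_vertex G v N) v"
          unfolding comp_of_new using comp_of_sym by fast
        then show ?thesis using w comp_of_eq[of w "add_vertex G v N" v] comp_of_new by simp
      qed
    qed
  qed
  have "?C \<in> ?L" unfolding comp_of_new[symmetric] by (auto simp: components_eq add_vertex_def)
  moreover have "D \<in> ?L" if D: "D \<in> ?R" for D
  proof -
    obtain w where w: "w \<in> verts G" "D = comp_of G w" using D by (auto simp: components_eq)
    then have "D = comp_of (add_vertex G v N) w" using comp_of_old D by blast
    then show ?thesis using w by (auto simp: components_eq add_vertex_def)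
  qed
  ultimately show "insert ?C ?R \<subseteq> ?L" by blast
qed

text \<open>Neighbors in different components have disjoint components, so the sizes add up exactly.
  Both strategies do their accounting with this equality.\<close>

lemma card_comp_of_new:
  assumes sep: "\<And>u w. u \<in> N \<Longrightarrow> w \<in> N \<Longrightarrow> w \<in> comp_of G u \<Longrightarrow> u = w"
  shows "card (comp_of (add_vertex G v N) v) = 1 + (\<Sum>u\<in>N. card (comp_of G u))"
proof -
  have fin: "finite N" using N G finite_subset by (auto simp: simple_graph_def)
  have fin': "finite (comp_of G u)" "comp_of G u \<subseteq> verts G" if "u \<in> N" for u
    using finite_comp_of[OF G] comp_of_verts[OF G] that N by blast+
  have "card (\<Union>u\<in>N. comp_of G u) = (\<Sum>u\<in>N. card (comp_of G u))"
  proof (intro card_UN_disjoint fin ballI impI fin')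
    fix u w assume "u \<in> N" "w \<in> N" "u \<noteq> w"
    then have "u \<notin> comp_of G w" using sep[of w u] by blast
    then show "comp_of G u \<inter> comp_of G w = {}" by (rule comp_of_disjoint)
  qed
  moreover have "v \<notin> (\<Union>u\<in>N. comp_of G u)" using fin' v by blast
  ultimately show ?thesis unfolding comp_of_new using fin fin'(1) by simp
qed

text \<open>A simple path in the old graph between two distinct neighbors of \<open>v\<close> would
  close up through \<open>v\<close> to a cycle.\<close>

lemma forest_add_vertexD:
  assumes F: "forest (add_vertex G v N)" and u: "u \<in> N" "w \<in> N" "w \<in> comp_of G u"
  shows "u = w"
proof (rule ccontr)
  assume "u \<noteq> w"
  obtain p where p: "p \<noteq> []" "distinct p" "hd p = u" "last p = w" "walk G p"
    using connected_simple_path[OF u(3)] by blast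
  have len: "2 \<le> length p" using p \<open>u \<noteq> w\<close> by (cases p) (auto simp: Suc_le_eq split: if_splits)
  have "set p \<subseteq> verts G"
  proof
    fix x assume "x \<in> set p"
    moreover have "u \<in> set p" using p(1,3) by auto
    ultimately have "x \<in> comp_of G u" using walk_connected[OF G p(5)] by blast
    then show "x \<in> verts G" using comp_of_verts[OF G, of u] u N by blast
  qed
  then have "v \<notin> set p" using v by blast
  \<comment> \<open>Position 0 is the edge from \<open>v\<close> to \<open>u\<close>, the last
    position the edge from \<open>w\<close> back to \<open>v\<close>; the others are edges of
    \<open>p\<close>.\<close>
  have "{(v # p) ! i, (v # p) ! (Suc i mod length (v # p))} \<in> edges (add_vertex G v N)"
    if i: "i < length (v # p)" for i
  proof (cases i)
    case 0
    then show ?thesis using p u len by (auto simp: edges_add_vertex simp flip: hd_conv_nth)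
  next
    case (Suc j)
    show ?thesis
    proof (cases "Suc j < length p")
      case True
      then have "{p ! j, p ! Suc j} \<in> edges G" using p(5) by (simp add: successively_conv_nth)
      then show ?thesis using Suc True by (auto simp: edges_add_vertex)
    next
      case False
      then have j: "Suc j = length p" using i Suc by simp
      then have "p ! j = w" using p by (metis diff_Suc_1 last_conv_nth)
      then have "(v # p) ! i = w" using Suc by simp
      moreover have "(v # p) ! (Suc i mod length (v # p)) = v" using Suc j by simp
      ultimately show ?thesis using u by (simp add: edges_add_vertex)
    qed
  qed
  then have "is_cycle (add_vertex G v N) (v # p)"
    using len p \<open>v \<notin> set p\<close> by (auto simp: is_cycle_def)
  then show False using F by (auto simp: forest_def)
qed

text \<open>A cycle of the new graph must use \<open>v\<close>. The rest of it connects the two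
  cyclic neighbors of \<open>v\<close> inside the old graph, and these are distinct because the
  cycle has at least three vertices.\<close>

lemma forest_add_vertex:
  assumes F: "forest G" and sep: "\<And>u w. u \<in> N \<Longrightarrow> w \<in> N \<Longrightarrow> w \<in> comp_of G u \<Longrightarrow> u = w"
  shows "forest (add_vertex G v N)"
proof -
  have "\<not> is_cycle (add_vertex G v N) c" for c
  proof
    assume c: "is_cycle (add_vertex G v N) c"
    define n where "n = length c"
    have n: "3 \<le> n" "distinct c" using c by (auto simp: is_cycle_def n_def)
    have edge: "{c ! (i mod n), c ! (Suc i mod n)} \<in> edges (add_vertex G v N)" for i
      using c n(1) unfolding is_cycle_def n_def[symmetric]
      by (metis mod_Suc_eq mod_less_divisor not_numeral_le_zero neq0_conv)
    have inj: "c ! (i mod n) = c ! (j mod n) \<longleftrightarrow> i mod n = j mod n" for i j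
      using n by (simp add: nth_eq_iff_index_eq n_def[symmetric])
    show False
    proof (cases "v \<in> set c")
      case False
      then have "{c ! i, c ! (Suc i mod n)} \<in> edges G" if "i < n" for i
        using edge[of i] that n unfolding edges_add_vertex
        by (metis mod_less mod_less_divisor n_def nth_mem not_numeral_le_zero neq0_conv)
      then have "is_cycle G c" using n by (auto simp: is_cycle_def n_def)
      then show False using F by (auto simp: forest_def)
    next
      case True
      then obtain i where i: "i < n" "c ! i = v" by (auto simp: in_set_conv_nth n_def)
      \<comment> \<open>Rotate the cycle so that it starts at \<open>v\<close>; indices are taken
        modulo \<open>n\<close>, hence also \<open>w n = v\<close>.\<close>
      define w where "w j = c ! ((i + j) mod n)" for j
      have w_eq: "j = j'" if "w j = w j'" "j < n" "j' < n" for j j'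
        using that i(1) unfolding w_def inj by (auto simp: mod_if split: if_splits)
      have w0: "w 0 = v" "w n = v" using i by (auto simp: w_def)
      have wE: "{w j, w (Suc j)} \<in> edges (add_vertex G v N)" for j
        using edge[of "i + j"] by (simp add: w_def)
      have wv: "w j \<noteq> v" if "0 < j" "j < n" for j
        using w_eq[of j 0] that w0 by auto
      have conn: "Suc j < n \<Longrightarrow> w (Suc j) \<in> comp_of G (w 1)" for j
      proof (induction j)
        case (Suc j)
        have "{w (Suc j), w (Suc (Suc j))} \<in> edges G"
          using wE[of "Suc j"] wv[of "Suc j"] wv[of "Suc (Suc j)"] Suc.prems by (auto simp: edges_add_vertex)
        then have "w (Suc (Suc j)) \<in> comp_of G (w (Suc j))"
          using edge_adjacency[OF G] by (auto simp: comp_of_def)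
        then show ?case using Suc comp_of_trans by (metis Suc_lessD)
      qed simp
      have "w 1 \<in> N" using wE[of 0] w0 wv[of 1] n v G by (auto simp: edges_add_vertex simple_graph_def)
      moreover have "w (n - 1) \<in> N"
        using wE[of "n - 1"] w0 wv[of "n - 1"] n v G by (auto simp: edges_add_vertex simple_graph_def)
      moreover have "n - 1 = Suc (n - 2)" using n by simp
      then have "w (n - 1) \<in> comp_of G (w 1)" using conn[of "n - 2"] n by simp
      ultimately have "w 1 = w (n - 1)" using sep by blast
      then show False using n w_eq[of 1 "n - 1"] by simp
    qed
  qed
  then show ?thesis using simple_add_vertex by (auto simp: forest_def)
qed

end

section \<open>Monochromatic paths and the strategy of Painter\<close>

text \<open>A new vertex, counted by the 1, joins pieces of lengths \<open>a1\<close>,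
  \<open>a2\<close> in color 1 and \<open>b1\<close>, \<open>b2\<close> in color 2. Strict
  monotonicity is what later absorbs this 1 when certificates are multiplied.\<close>

definition certificate :: "(nat \<Rightarrow> nat) \<Rightarrow> (nat \<Rightarrow> nat) \<Rightarrow> bool" where
  "certificate g h \<longleftrightarrow> g 0 = 0 \<and> h 0 = 0 \<and> strict_mono g \<and> strict_mono h \<and>
     (\<forall>a1 a2 b1 b2. g (a1 + a2 + 1) \<le> 1 + g a1 + g a2 + h b1 + h b2 \<or>
                    h (b1 + b2 + 1) \<le> 1 + g a1 + g a2 + h b1 + h b2)"

text \<open>The empty list is a path of length 0 in every color, so a missing piece next to a new
  vertex is treated like any other piece.\<close>

definition mono_path :: "'a graph \<Rightarrow> ('a \<Rightarrow> nat) \<Rightarrow> nat \<Rightarrow> 'a list \<Rightarrow> bool" where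
  "mono_path G col s p \<longleftrightarrow> distinct p \<and> set p \<subseteq> verts G \<and> (\<forall>x\<in>set p. col x = s) \<and> walk G p"

lemma mono_path_verts: "mono_path G col s p \<Longrightarrow> x \<in> set p \<Longrightarrow> x \<in> verts G"
  by (auto simp: mono_path_def)

lemma painter_lost_iff:
  "painter_lost r (\<lambda>_. path_graph l) G col \<longleftrightarrow> (\<exists>s\<in>{1..r}. \<exists>p. mono_path G col s p \<and> length p = l)"
proof
  assume "painter_lost r (\<lambda>_. path_graph l) G col"
  then obtain s H f where s: "s \<in> {1..r}" and H: "subgraph H G" "\<forall>v\<in>verts H. col v = s"
    and f: "bij_betw f {..<l} (verts H)" "edges H = (\<lambda>e. f ` e) ` {{i, Suc i} |i. Suc i < l}"
    by (auto simp: painter_lost_def graph_iso_def path_graph_def)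
  have "{f i, f (Suc i)} \<in> edges G" if "Suc i < l" for i
  proof -
    have "f ` {i, Suc i} \<in> edges H" unfolding f(2) using that by blast
    then show ?thesis using H by (auto simp: subgraph_def)
  qed
  then have "mono_path G col s (map f [0..<l])"
    using f(1) H by (auto simp: mono_path_def bij_betw_def distinct_map subgraph_def successively_conv_nth
      atLeast0LessThan)
  then show "\<exists>s\<in>{1..r}. \<exists>p. mono_path G col s p \<and> length p = l"
    using s by (intro bexI[of _ s] exI[of _ "map f [0..<l]"]) simp
next
  assume "\<exists>s\<in>{1..r}. \<exists>p. mono_path G col s p \<and> length p = l"
  then obtain s p where s: "s \<in> {1..r}" and p: "mono_path G col s p" "length p = l" by blast
  \<comment> \<open>A copy need not be an induced subgraph, so only edges between consecutive
    entries are kept.\<close>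
  define H where "H = (set p, (\<lambda>e. (!) p ` e) ` {{i, Suc i} |i. Suc i < l})"
  have E: "(\<lambda>e. (!) p ` e) ` {{i, Suc i} |i. Suc i < l} = {{p ! i, p ! Suc i} |i. Suc i < l}"
    by (auto simp: image_iff) (metis image_empty image_insert)+
  have "bij_betw ((!) p) {..<l} (set p)"
    using p bij_betw_nth[of p "{..<l}" "set p"] by (auto simp: mono_path_def)
  then have "graph_iso (path_graph l) H"
    unfolding graph_iso_def path_graph_def H_def by (intro exI[of _ "(!) p"]) simp
  moreover have "simple_graph H" unfolding simple_graph_def H_def snd_conv fst_conv E
    using p by (auto simp: mono_path_def card_insert_if nth_eq_iff_index_eq)
  then have "subgraph H G" unfolding subgraph_def using p unfolding H_def fst_conv snd_conv E
    by (auto simp: mono_path_def successively_conv_nth)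
  moreover have "\<forall>v\<in>verts H. col v = s" using p by (simp add: H_def mono_path_def)
  ultimately show "painter_lost r (\<lambda>_. path_graph l) G col"
    using s unfolding painter_lost_def by blast
qed

text \<open>A simple path passes \<open>v\<close> only once, so what lies on either side of it was
  already a path of the old board.\<close>

lemma mono_path_split_new:
  assumes G: "simple_graph G" "v \<notin> verts G" "N \<subseteq> verts G"
    and p: "mono_path (add_vertex G v N) (col(v := c)) s p" "v \<in> set p"
  obtains q r where "p = q @ v # r" "s = c" "mono_path G col c q" "mono_path G col c r"
    "q \<noteq> [] \<Longrightarrow> last q \<in> N" "r \<noteq> [] \<Longrightarrow> hd r \<in> N"
proof -
  obtain q r where qr: "p = q @ v # r" using p(2) by (meson split_list)
  have s: "s = c" using p by (auto simp: mono_path_def)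
  note E = edges_add_vertex[OF G]
  have d: "v \<notin> set q" "v \<notin> set r" using p(1) by (auto simp: mono_path_def qr)
  have w: "walk (add_vertex G v N) q" "walk (add_vertex G v N) r"
     "q \<noteq> [] \<Longrightarrow> {last q, v} \<in> edges (add_vertex G v N)" "r \<noteq> [] \<Longrightarrow> {v, hd r} \<in> edges (add_vertex G v N)"
    using p(1) by (auto simp: mono_path_def qr successively_append_iff successively_Cons)
  have w': "walk G q" "walk G r"
    using w d by (auto elim!: successively_mono simp: E)
  have sub: "set q \<subseteq> verts G" "set r \<subseteq> verts G" 
    using p(1) d by (auto simp: mono_path_def qr add_vertex_def)
  have colq: "\<forall>x\<in>set q. col x = c" "\<forall>x\<in>set r. col x = c"
    using p(1) d s by (auto simp: mono_path_def qr split: if_splits)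
  have m: "mono_path G col c q" "mono_path G col c r"
    using p(1) w' sub colq by (auto simp: mono_path_def qr)
  have no: "{x, v} \<notin> edges G" "{v, x} \<notin> edges G" for x
    using G by (auto simp: simple_graph_def)
  have "last q \<in> N" if "q \<noteq> []" using w(3)[OF that] no that d(1) unfolding E by auto
  moreover have "hd r \<in> N" if "r \<noteq> []" using w(4)[OF that] no that d(2) unfolding E by auto
  ultimately show ?thesis using that qr s m by blast
qed

text \<open>The invariant of Painter: \<open>f s a\<close> is the size a component must have reached
  before a path on \<open>a\<close> vertices of color \<open>s\<close> is tolerated in it. A path
  lies in one component, which its first vertex identifies.\<close>

definition heavy :: "(nat \<Rightarrow> nat \<Rightarrow> nat) \<Rightarrow> nat graph \<Rightarrow> (nat \<Rightarrow> nat) \<Rightarrow> bool" where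
  "heavy f G col \<longleftrightarrow> (\<forall>s\<in>{1..2}. \<forall>p. p \<noteq> [] \<and> mono_path G col s p \<longrightarrow> f s (length p) \<le> card (comp_of G (hd p)))"

lemma heavy_add_vertex:
  assumes certificate: "certificate g h" and f: "f = (\<lambda>s. if s = 1 then g else h)"
    and heavy: "heavy f G col" and G: "simple_graph G" "v \<notin> verts G" "N \<subseteq> verts G"
    and F: "forest (add_vertex G v N)"
  shows "\<exists>c\<in>{1..2}. heavy f (add_vertex G v N) (col(v := c))"
proof (rule ccontr)
  let ?G = "add_vertex G v N"
  let ?S = "card (comp_of ?G v)"
  note sep = forest_add_vertexD[OF G F]
  note simple = simple_add_vertex[OF G]
  have finN: "finite N" using G finite_subset by (auto simp: simple_graph_def)
  have f0: "f s 0 = 0" for s using certificate f by (auto simp: certificate_def)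
  assume neg: "\<not> ?thesis"
  have split: "\<exists>a b M. M \<subseteq> N \<and> (\<forall>x\<in>M. col x = c) \<and> f c a + f c b \<le> (\<Sum>u\<in>M. card (comp_of G u)) \<and> ?S < f c (a + b + 1)"
    if c: "c \<in> {1..2}" for c
  proof -
    obtain s p where s: "s \<in> {1..2}" and p: "p \<noteq> []" "mono_path ?G (col(v := c)) s p"
      and less: "card (comp_of ?G (hd p)) < f s (length p)"
      using neg c unfolding heavy_def by (meson not_le)
    \<comment> \<open>A path avoiding \<open>v\<close> was there before the move, and its component
      has not shrunk, so it cannot violate the invariant.\<close>
    have "v \<in> set p"
    proof (rule ccontr)
      assume nv: "v \<notin> set p"
      have "walk ?G p" using p(2) by (simp add: mono_path_def)
      then have "walk G p" by (rule successively_mono) (use nv in \<open>auto simp: edges_add_vertex[OF G]\<close>)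
      moreover have "\<forall>x\<in>set p. col x = s" using p(2) nv by (auto simp: mono_path_def split: if_splits)
      ultimately have "mono_path G col s p"
        using p(2) nv by (auto simp: mono_path_def add_vertex_def)
      then have "f s (length p) \<le> card (comp_of G (hd p))" using heavy s p(1) by (auto simp: heavy_def)
      also have "\<dots> \<le> card (comp_of ?G (hd p))"
        using comp_of_mono[OF G] finite_comp_of[OF simple] mono_path_verts[OF p(2)] p(1)
        by (intro card_mono) auto
      finally show False using less by simp
    qed
    then obtain q r where qr: "p = q @ v # r" "s = c" "mono_path G col c q" "mono_path G col c r"
      "q \<noteq> [] \<Longrightarrow> last q \<in> N" "r \<noteq> [] \<Longrightarrow> hd r \<in> N"
      using mono_path_split_new[OF G p(2)] by metis
    have "walk ?G p" using p(2) by (simp add: mono_path_def)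
    then have "comp_of ?G (hd p) = comp_of ?G v"
      using walk_connected[OF simple] \<open>v \<in> set p\<close> p(1) by (intro comp_of_eq) auto
    then have S: "?S < f c (length q + length r + 1)" using less qr by simp
    \<comment> \<open>The neighbors of \<open>v\<close> at which the two pieces are attached; an
      empty piece has none and, by \<open>f0\<close>, costs nothing.\<close>
    define Q R where "Q = (if q = [] then {} else {last q})" and "R = (if r = [] then {} else {hd r})"
    have q: "f c (length q) \<le> (\<Sum>u\<in>Q. card (comp_of G u))"
    proof (cases "q = []")
      case False
      then have "comp_of G (last q) = comp_of G (hd q)"
        using qr(3) comp_of_eq[OF walk_connected[OF G(1), of q "hd q" "last q"]] by (simp add: mono_path_def)
      then show ?thesis using heavy c qr(3) False by (auto simp: heavy_def Q_def)
    qed (simp add: f0)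
    have r: "f c (length r) \<le> (\<Sum>u\<in>R. card (comp_of G u))"
      using heavy c qr(4) by (auto simp: heavy_def R_def f0)
    have "Q \<subseteq> set q" "R \<subseteq> set r" by (auto simp: Q_def R_def)
    moreover have "set q \<inter> set r = {}" using p(2) by (auto simp: qr(1) mono_path_def)
    ultimately have "Q \<inter> R = {}" by blast
    then have "(\<Sum>u\<in>Q \<union> R. card (comp_of G u)) = (\<Sum>u\<in>Q. card (comp_of G u)) + (\<Sum>u\<in>R. card (comp_of G u))"
      by (intro sum.union_disjoint) (auto simp: Q_def R_def)
    moreover have "Q \<union> R \<subseteq> N" using qr(5,6) by (auto simp: Q_def R_def)
    moreover have "\<forall>x\<in>Q \<union> R. col x = c" using qr(3,4) by (auto simp: Q_def R_def mono_path_def)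
    ultimately show ?thesis using S q r by (intro exI[of _ "length q"] exI[of _ "length r"] exI[of _ "Q \<union> R"]) linarith
  qed
  obtain a1 a2 M1 where 1: "M1 \<subseteq> N" "\<forall>x\<in>M1. col x = 1" "g a1 + g a2 \<le> (\<Sum>u\<in>M1. card (comp_of G u))" "?S < g (a1 + a2 + 1)"
    using split[of 1] unfolding f by auto
  obtain b1 b2 M2 where 2: "M2 \<subseteq> N" "\<forall>x\<in>M2. col x = 2" "h b1 + h b2 \<le> (\<Sum>u\<in>M2. card (comp_of G u))" "?S < h (b1 + b2 + 1)"
    using split[of 2] unfolding f by auto
  \<comment> \<open>A neighbor has only one color, so none is counted for both failing
    colors.\<close>
  have "M1 \<inter> M2 = {}" using 1(2) 2(2) by fastforce
  then have "(\<Sum>u\<in>M1. card (comp_of G u)) + (\<Sum>u\<in>M2. card (comp_of G u)) = (\<Sum>u\<in>M1 \<union> M2. card (comp_of G u))"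
    using 1(1) 2(1) finN by (subst sum.union_disjoint) (auto intro: finite_subset)
  also have "\<dots> \<le> (\<Sum>u\<in>N. card (comp_of G u))"
    using 1(1) 2(1) finN by (intro sum_mono2) auto
  finally have "1 + g a1 + g a2 + h b1 + h b2 \<le> ?S"
    using 1(3) 2(3) card_comp_of_new[OF G sep] by simp
  moreover have "g (a1 + a2 + 1) \<le> 1 + g a1 + g a2 + h b1 + h b2 \<or> h (b1 + b2 + 1) \<le> 1 + g a1 + g a2 + h b1 + h b2"
    using certificate unfolding certificate_def by blast
  ultimately show False using 1(4) 2(4) by linarith
qed

text \<open>Under the invariant a monochromatic path on \<open>l\<close> vertices needs a component
  larger than \<open>k\<close>, and Painter can always preserve the invariant.\<close>

lemma painter_survives:
  assumes certificate: "certificate g h" and l: "0 < l" "k < g l" "k < h l"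
  shows "\<not> builder_wins 2 (\<lambda>_. path_graph l) k"
proof -
  define f where f: "f = (\<lambda>s :: nat. if s = 1 then g else h)"
  have safe: "\<not> painter_lost 2 (\<lambda>_. path_graph l) G col"
    if G: "\<forall>C\<in>components G. card C \<le> k" "heavy f G col" for G col
  proof
    assume "painter_lost 2 (\<lambda>_. path_graph l) G col"
    then obtain s p where p: "s \<in> {1..2}" "mono_path G col s p" "length p = l"
      unfolding painter_lost_iff by blast
    then have ne: "p \<noteq> []" using l(1) by auto
    then have "f s l \<le> card (comp_of G (hd p))" using p G(2) by (auto simp: heavy_def)
    also have "\<dots> \<le> k" using mono_path_verts[OF p(2)] ne G(1) unfolding components_eq by auto
    finally show False using l by (auto simp: f split: if_splits)
  qed
  have "\<not> builder_forces 2 (\<lambda>_. path_graph l) k n G col"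
    if "simple_graph G" "\<forall>C\<in>components G. card C \<le> k" "heavy f G col" for n G col
    using that
  proof (induction n arbitrary: G col)
    case 0
    then show ?case using safe by simp
  next
    case (Suc n)
    show ?case
    proof
      assume "builder_forces 2 (\<lambda>_. path_graph l) k (Suc n) G col"
      then obtain v N where v: "legal_move k G v N"
        "\<forall>c\<in>{1..2}. builder_forces 2 (\<lambda>_. path_graph l) k n (add_vertex G v N) (col(v := c))"
        using safe Suc.prems by auto
      have v': "v \<notin> verts G" "N \<subseteq> verts G" "forest (add_vertex G v N)"
        "\<forall>C\<in>components (add_vertex G v N). card C \<le> k"
        using v(1) by (auto simp: legal_move_def)
      obtain c where "c \<in> {1..2}" "heavy f (add_vertex G v N) (col(v := c))"
        using heavy_add_vertex[OF certificate f Suc.prems(3,1) v'(1-3)] by blast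
      then show False
        using Suc.IH v(2) v'(4) simple_add_vertex[OF Suc.prems(1) v'(1,2)] by blast
    qed
  qed
  moreover have "heavy f ({}, {}) (\<lambda>_. 0)" by (auto simp: heavy_def mono_path_def)
  moreover have "simple_graph ({}, {})" "\<forall>C\<in>components ({}, {}). card C \<le> k"
    by (auto simp: simple_graph_def components_def)
  ultimately show ?thesis unfolding builder_wins_def by blast
qed

section \<open>Products of certificates\<close>

text \<open>
  A cell is a certificate restricted to lengths below \<open>l\<close> and \<open>c\<close>. When lengths carry over in
  both colors, the new vertex must pay for a full unit \<open>k\<close> on the next scale in addition to
  the remainder.
\<close>

definition certificate_cell :: "nat \<Rightarrow> nat \<Rightarrow> nat \<Rightarrow> (nat \<Rightarrow> nat) \<Rightarrow> (nat \<Rightarrow> nat) \<Rightarrow> bool" where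
  "certificate_cell l c k g h \<longleftrightarrow> 0 < l \<and> 0 < c \<and> g 0 = 0 \<and> h 0 = 0 \<and>
     strict_mono_on {..<l} g \<and> strict_mono_on {..<c} h \<and> (\<forall>r<l. g r < k) \<and> (\<forall>s<c. h s < k) \<and>
     (\<forall>r1<l. \<forall>r2<l. \<forall>s1<c. \<forall>s2<c.
        let S = 1 + g r1 + g r2 + h s1 + h s2; r = r1 + r2 + 1; s = s1 + s2 + 1 in
        if r < l then if s < c then g r \<le> S \<or> h s \<le> S else g r \<le> S
        else if s < c then h s \<le> S else k + g (r - l) \<le> S \<and> k + h (s - c) \<le> S)"

text \<open>Two scales: \<open>g\<close> prices the full blocks of \<open>l\<close> vertices in
  units of \<open>k\<close>, and \<open>g0\<close> prices the incomplete block.\<close>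

definition blowup :: "nat \<Rightarrow> nat \<Rightarrow> (nat \<Rightarrow> nat) \<Rightarrow> (nat \<Rightarrow> nat) \<Rightarrow> nat \<Rightarrow> nat" where
  "blowup l k g0 g x = k * g (x div l) + g0 (x mod l)"

lemma certificate_sym:
  assumes "certificate g h"
  shows "certificate h g"
proof -
  have "h (a1 + a2 + 1) \<le> 1 + h a1 + h a2 + g b1 + g b2 \<or> g (b1 + b2 + 1) \<le> 1 + h a1 + h a2 + g b1 + g b2"
    for a1 a2 b1 b2
  proof -
    have "g (b1 + b2 + 1) \<le> 1 + g b1 + g b2 + h a1 + h a2 \<or> h (a1 + a2 + 1) \<le> 1 + g b1 + g b2 + h a1 + h a2"
      using assms unfolding certificate_def by blast
    moreover have eq: "1 + g b1 + g b2 + h a1 + h a2 = 1 + h a1 + h a2 + g b1 + g b2" by simp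
    ultimately show ?thesis unfolding eq by blast
  qed
  then show ?thesis using assms unfolding certificate_def by blast
qed

lemma certificate_cell_sym:
  assumes "certificate_cell l c k g h"
  shows "certificate_cell c l k h g"
proof -
  have "let S = 1 + h s1 + h s2 + g r1 + g r2; s = s1 + s2 + 1; r = r1 + r2 + 1 in
        if s < c then if r < l then h s \<le> S \<or> g r \<le> S else h s \<le> S
        else if r < l then g r \<le> S else k + h (s - c) \<le> S \<and> k + g (r - l) \<le> S"
    if "r1 < l" "r2 < l" "s1 < c" "s2 < c" for r1 r2 s1 s2
  proof -
    have "let S = 1 + g r1 + g r2 + h s1 + h s2; r = r1 + r2 + 1; s = s1 + s2 + 1 in
        if r < l then if s < c then g r \<le> S \<or> h s \<le> S else g r \<le> S
        else if s < c then h s \<le> S else k + g (r - l) \<le> S \<and> k + h (s - c) \<le> S"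
      using assms that unfolding certificate_cell_def by blast
    moreover have eq: "1 + g r1 + g r2 + h s1 + h s2 = 1 + h s1 + h s2 + g r1 + g r2" by simp
    ultimately show ?thesis unfolding Let_def eq by (auto split: if_splits)
  qed
  then show ?thesis using assms unfolding certificate_cell_def by blast
qed

lemma certificate_id: "certificate (\<lambda>x. x) (\<lambda>x. x)"
  by (auto simp: certificate_def strict_mono_def)

text \<open>When the remainder wraps around, \<open>g0\<close> falls by less than \<open>k\<close>
  while the next scale rises by at least \<open>k\<close>.\<close>

lemma strict_mono_blowup:
  assumes "strict_mono g" "strict_mono_on {..<l} g0" "\<forall>r<l. g0 r < k" "0 < l"
  shows "strict_mono (blowup l k g0 g)"
  unfolding strict_mono_Suc_iff
proof
  fix x
  show "blowup l k g0 g x < blowup l k g0 g (Suc x)"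
  proof (cases "Suc (x mod l) = l")
    case True
    have d: "Suc x div l = Suc (x div l)" "Suc x mod l = 0"
      using True by (auto simp: div_Suc mod_Suc)
    have "k * g (x div l) + g0 (x mod l) < k * g (x div l) + k"
      using assms by simp
    also have "\<dots> = k * (g (x div l) + 1)" by simp
    also have "\<dots> \<le> k * g (Suc (x div l))"
      using assms(1) by (intro mult_le_mono) (auto simp: Suc_le_eq strict_mono_Suc_iff)
    finally show ?thesis unfolding blowup_def d by simp
  next
    case False
    have d: "Suc x div l = x div l" "Suc x mod l = Suc (x mod l)"
      using False by (auto simp: div_Suc mod_Suc)
    have "Suc (x mod l) < l" using False assms(4) by (metis Suc_lessI mod_less_divisor)
    then have "g0 (x mod l) < g0 (Suc (x mod l))"
      using assms(2) by (simp add: strict_mono_on_def)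
    then show ?thesis unfolding blowup_def d by simp
  qed
qed

text \<open>Addition in base \<open>l\<close> with the new vertex as an incoming carry of 1. The
  total of the remainders is below \<open>2 * l\<close>, so at most one carry goes out.\<close>

lemma div_mod_carry:
  fixes x y l :: nat
  assumes "0 < l"
  shows "x mod l + y mod l + 1 < l \<Longrightarrow> (x + y + 1) div l = x div l + y div l \<and> (x + y + 1) mod l = x mod l + y mod l + 1"
    and "l \<le> x mod l + y mod l + 1 \<Longrightarrow> (x + y + 1) div l = x div l + y div l + 1 \<and> (x + y + 1) mod l = x mod l + y mod l + 1 - l"
proof -
  define r where "r = x mod l + y mod l + 1"
  have eq: "x + y + 1 = (x div l + y div l) * l + r"
    using div_mult_mod_eq[of x l] div_mult_mod_eq[of y l] unfolding distrib_right r_def by linarith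
  show "x mod l + y mod l + 1 < l \<Longrightarrow> (x + y + 1) div l = x div l + y div l \<and> (x + y + 1) mod l = x mod l + y mod l + 1"
    unfolding eq unfolding r_def[symmetric] using assms by simp
  have "r < 2 * l" unfolding r_def
    using mod_less_divisor[OF assms, of x] mod_less_divisor[OF assms, of y] by linarith
  then show "l \<le> x mod l + y mod l + 1 \<Longrightarrow> (x + y + 1) div l = x div l + y div l + 1 \<and> (x + y + 1) mod l = x mod l + y mod l + 1 - l"
    unfolding eq unfolding r_def[symmetric] using assms
    by (simp add: le_mod_geq div_add1_eq div_nat_eqI le_div_geq)
qed

lemma strict_mono_pred: "strict_mono (g :: nat \<Rightarrow> nat) \<Longrightarrow> 0 < i \<Longrightarrow> g (i - 1) + 1 \<le> g i"
  by (simp add: Suc_le_eq strict_mono_def)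

text \<open>Shortening a nonempty piece of the second color by one vertex lowers \<open>h\<close> by
  at least 1, and this pays for the new vertex.\<close>

lemma certificate_excess:
  assumes "certificate g h" "0 < j1 + j2"
  shows "g (i1 + i2 + 1) \<le> g i1 + g i2 + h j1 + h j2 \<or> h (j1 + j2) \<le> g i1 + g i2 + h j1 + h j2"
proof -
  have *: "g (i1 + i2 + 1) \<le> g i1 + g i2 + h j1 + h j2 \<or> h (j1 + j2) \<le> g i1 + g i2 + h j1 + h j2"
    if "0 < j1" for j1 j2
  proof -
    have "h (j1 - 1) + 1 \<le> h j1" using assms that by (simp add: certificate_def strict_mono_pred del: One_nat_def)
    moreover have "g (i1 + i2 + 1) \<le> 1 + g i1 + g i2 + h (j1 - 1) + h j2 \<or>
       h (j1 - 1 + j2 + 1) \<le> 1 + g i1 + g i2 + h (j1 - 1) + h j2"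
      using assms(1) unfolding certificate_def by blast
    moreover have eq: "j1 - 1 + j2 + 1 = j1 + j2" using that by simp
    ultimately show ?thesis unfolding eq by linarith
  qed
  show ?thesis
  proof (cases "0 < j1")
    case True then show ?thesis by (rule *)
  next
    case False
    then have "0 < j2" using assms by simp
    from *[OF this, of j1] show ?thesis by (simp add: add_ac)
  qed
qed

text \<open>The saving is made in both colors: one unit pays for the new vertex, the other is the
  surplus.\<close>

lemma certificate_excess2:
  assumes "certificate g h" "0 < i1 + i2" "0 < j1 + j2"
  shows "g (i1 + i2) + 1 \<le> g i1 + g i2 + h j1 + h j2 \<or> h (j1 + j2) + 1 \<le> g i1 + g i2 + h j1 + h j2"
proof -
  have *: "g (i1 + i2) + 1 \<le> g i1 + g i2 + h j1 + h j2 \<or> h (j1 + j2) + 1 \<le> g i1 + g i2 + h j1 + h j2"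
    if "0 < i1" for i1 i2
  proof -
    have "g (i1 - 1) + 1 \<le> g i1" using assms that by (simp add: certificate_def strict_mono_pred del: One_nat_def)
    moreover have "g (i1 - 1 + i2 + 1) \<le> g (i1 - 1) + g i2 + h j1 + h j2 \<or>
       h (j1 + j2) \<le> g (i1 - 1) + g i2 + h j1 + h j2"
      using assms by (intro certificate_excess) auto
    moreover have eq: "i1 - 1 + i2 + 1 = i1 + i2" using that by simp
    ultimately show ?thesis unfolding eq by linarith
  qed
  show ?thesis
  proof (cases "0 < i1")
    case True then show ?thesis by (rule *)
  next
    case False
    then have "0 < i2" using assms by simp
    from *[OF this, of i1] show ?thesis by (simp add: add_ac)
  qed
qed

text \<open>Carries in both colors are a genuine move on the next scale, whose new vertex is the
  extra \<open>k\<close> paid by the cell. With one carry nothing has to be paid there. With none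
  there is even a surplus of \<open>k\<close>, unless no full block is involved and the cell alone
  decides.\<close>

lemma certificate_blowup:
  assumes certificate_cell: "certificate_cell l c k g0 h0" and certificate: "certificate g h"
  shows "certificate (blowup l k g0 g) (blowup c k h0 h)"
proof -
  have l: "0 < l" "0 < c" using certificate_cell by (auto simp: certificate_cell_def)
  have lt: "\<And>r. r < l \<Longrightarrow> g0 r < k" "\<And>s. s < c \<Longrightarrow> h0 s < k" using certificate_cell by (auto simp: certificate_cell_def)
  have mono: "\<And>r r'. r \<le> r' \<Longrightarrow> r' < l \<Longrightarrow> g0 r \<le> g0 r'" "\<And>r r'. r \<le> r' \<Longrightarrow> r' < c \<Longrightarrow> h0 r \<le> h0 r'"
    using certificate_cell unfolding certificate_cell_def strict_mono_on_def
    by (metis lessThan_iff le_neq_implies_less less_le_trans less_imp_le order_refl le_less_trans)+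
  have z: "g 0 = 0" "h 0 = 0" using certificate by (auto simp: certificate_def)
  have pos: "g i \<ge> 1" if "0 < i" for i
    using certificate that z(1) unfolding certificate_def strict_mono_def by (metis One_nat_def Suc_leI)
  have posh: "h i \<ge> 1" if "0 < i" for i
    using certificate that z(2) unfolding certificate_def strict_mono_def by (metis One_nat_def Suc_leI)
  have scale: "k * x + m \<le> k * y + n" if "x \<le> y" "m \<le> n" for x y m n :: nat
    using that by (simp add: add_mono)
  have scale1: "k * x + m \<le> k * y + n" if "x + 1 \<le> y" "m \<le> k + n" for x y m n :: nat
  proof -
    have "k * x + m \<le> k * (x + 1) + n" using that(2) by simp
    also have "\<dots> \<le> k * y + n" using that(1) by (intro add_mono mult_le_mono) auto
    finally show ?thesis .
  qed
  have scale2: "k * x + m \<le> k * y + n" if "x \<le> 1 + y" "k + m \<le> n" for x y m n :: nat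
  proof -
    have "k * x + m \<le> k * (1 + y) + m" using that(1) by (intro add_mono mult_le_mono) auto
    also have "\<dots> \<le> k * y + n" using that(2) by (simp add: algebra_simps)
    finally show ?thesis .
  qed
  have main: "blowup l k g0 g (a1 + a2 + 1) \<le> 1 + blowup l k g0 g a1 + blowup l k g0 g a2 + blowup c k h0 h b1 + blowup c k h0 h b2 \<or> blowup c k h0 h (b1 + b2 + 1) \<le> 1 + blowup l k g0 g a1 + blowup l k g0 g a2 + blowup c k h0 h b1 + blowup c k h0 h b2"
    (is "?X \<le> _ \<or> ?Y \<le> _")
    for a1 a2 b1 b2
  proof -
    define i1 i2 j1 j2 where "i1 = a1 div l" and "i2 = a2 div l" and "j1 = b1 div c" and "j2 = b2 div c"
    define r1 r2 s1 s2 where "r1 = a1 mod l" and "r2 = a2 mod l" and "s1 = b1 mod c" and "s2 = b2 mod c"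
    note defs = i1_def i2_def j1_def j2_def r1_def r2_def s1_def s2_def
    have rs: "r1 < l" "r2 < l" "s1 < c" "s2 < c" using l by (auto simp: defs)
    define U where "U = g i1 + g i2 + h j1 + h j2"
    define S where "S = 1 + g0 r1 + g0 r2 + h0 s1 + h0 s2"
    have T: "1 + blowup l k g0 g a1 + blowup l k g0 g a2 + blowup c k h0 h b1 + blowup c k h0 h b2 = k * U + S"
      unfolding blowup_def U_def S_def defs by (simp add: algebra_simps)
    have base: "if r1 + r2 + 1 < l then if s1 + s2 + 1 < c then g0 (r1 + r2 + 1) \<le> S \<or> h0 (s1 + s2 + 1) \<le> S else g0 (r1 + r2 + 1) \<le> S
        else if s1 + s2 + 1 < c then h0 (s1 + s2 + 1) \<le> S else k + g0 (r1 + r2 + 1 - l) \<le> S \<and> k + h0 (s1 + s2 + 1 - c) \<le> S"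
      using certificate_cell rs unfolding certificate_cell_def Let_def S_def by blast
    have A: "blowup l k g0 g (a1 + a2 + 1) = (if r1 + r2 + 1 < l then k * g (i1 + i2) + g0 (r1 + r2 + 1)
         else k * g (i1 + i2 + 1) + g0 (r1 + r2 + 1 - l))"
      using div_mod_carry[OF l(1), of a1 a2] unfolding blowup_def defs by auto
    have B: "blowup c k h0 h (b1 + b2 + 1) = (if s1 + s2 + 1 < c then k * h (j1 + j2) + h0 (s1 + s2 + 1)
         else k * h (j1 + j2 + 1) + h0 (s1 + s2 + 1 - c))"
      using div_mod_carry[OF l(2), of b1 b2] unfolding blowup_def defs by auto
    \<comment> \<open>After a carry the remainder is at most \<open>r1\<close>, since
      \<open>r2 < l\<close>.\<close>
    have dg: "g0 (r1 + r2 + 1 - l) \<le> S" if "\<not> r1 + r2 + 1 < l"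
      using mono(1)[of "r1 + r2 + 1 - l" r1] rs unfolding S_def by linarith
    have dh: "h0 (s1 + s2 + 1 - c) \<le> S" if "\<not> s1 + s2 + 1 < c"
      using mono(2)[of "s1 + s2 + 1 - c" s1] rs unfolding S_def by linarith
    show ?thesis unfolding T
    proof (cases "r1 + r2 + 1 < l"; cases "s1 + s2 + 1 < c")
      assume c: "\<not> r1 + r2 + 1 < l" "\<not> s1 + s2 + 1 < c"
      have "g (i1 + i2 + 1) \<le> 1 + U \<or> h (j1 + j2 + 1) \<le> 1 + U"
        using certificate unfolding certificate_def U_def add.assoc by blast
      moreover have "k + g0 (r1 + r2 + 1 - l) \<le> S" "k + h0 (s1 + s2 + 1 - c) \<le> S" using base c by auto
      ultimately show "?X \<le> k * U + S \<or> ?Y \<le> k * U + S"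
        unfolding A B if_not_P[OF c(1)] if_not_P[OF c(2)] by (elim disjE) (auto intro: scale2)
    next
      assume c: "\<not> r1 + r2 + 1 < l" "s1 + s2 + 1 < c"
      have h0: "h0 (s1 + s2 + 1) \<le> S" using base c by simp
      have "g (i1 + i2 + 1) \<le> U \<or> h (j1 + j2) \<le> U"
      proof (cases "0 < j1 + j2")
        case True then show ?thesis using certificate_excess[OF certificate, of j1 j2 i1 i2] unfolding U_def by simp
      next
        case False then show ?thesis using z by simp
      qed
      then show "?X \<le> k * U + S \<or> ?Y \<le> k * U + S"
        unfolding A B if_not_P[OF c(1)] if_P[OF c(2)]
        using dg[OF c(1)] h0 by (elim disjE) (auto intro: scale)
    next
      assume c: "r1 + r2 + 1 < l" "\<not> s1 + s2 + 1 < c"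
      have g0: "g0 (r1 + r2 + 1) \<le> S" using base c by simp
      have "h (j1 + j2 + 1) \<le> U \<or> g (i1 + i2) \<le> U"
      proof (cases "0 < i1 + i2")
        case True then show ?thesis using certificate_excess[OF certificate_sym[OF certificate], of i1 i2 j1 j2] unfolding U_def
          by (simp add: add_ac)
      next
        case False then show ?thesis using z by simp
      qed
      then show "?X \<le> k * U + S \<or> ?Y \<le> k * U + S"
        unfolding A B if_not_P[OF c(2)] if_P[OF c(1)]
        using dh[OF c(2)] g0 by (elim disjE) (auto intro: scale)
    next
      assume c: "r1 + r2 + 1 < l" "s1 + s2 + 1 < c"
      have g0: "g0 (r1 + r2 + 1) \<le> k + S" and h0: "h0 (s1 + s2 + 1) \<le> k + S" 
        using lt(1)[OF c(1)] lt(2)[OF c(2)] by auto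
      have X: "?X = k * g (i1 + i2) + g0 (r1 + r2 + 1)" and Y: "?Y = k * h (j1 + j2) + h0 (s1 + s2 + 1)"
        using A B c by simp_all
      \<comment> \<open>If a full block is present in either color, \<open>U\<close> exceeds one of
        the two targets by 1, and this unit covers a whole remainder below \<open>k\<close>.\<close>
      consider "i1 + i2 = 0" "j1 + j2 = 0" | "0 < i1 + i2" "j1 + j2 = 0" | "i1 + i2 = 0" "0 < j1 + j2"
        | "0 < i1 + i2" "0 < j1 + j2" by linarith
      then show "?X \<le> k * U + S \<or> ?Y \<le> k * U + S"
      proof cases
        case 1
        have "g0 (r1 + r2 + 1) \<le> S \<or> h0 (s1 + s2 + 1) \<le> S" using base c by simp
        then show ?thesis unfolding X Y 1 z by (auto intro: trans_le_add2)
      next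
        case 2
        then have "h (j1 + j2) + 1 \<le> U" using pos[of i1] pos[of i2] z unfolding U_def 2 by linarith
        from scale1[OF this h0] show ?thesis unfolding Y by blast
      next
        case 3
        then have "g (i1 + i2) + 1 \<le> U" using posh[of j1] posh[of j2] z unfolding U_def 3 by linarith
        from scale1[OF this g0] show ?thesis unfolding X by blast
      next
        case 4
        from certificate_excess2[OF certificate 4] have "g (i1 + i2) + 1 \<le> U \<or> h (j1 + j2) + 1 \<le> U" unfolding U_def .
        then show ?thesis unfolding X Y using scale1[OF _ g0] scale1[OF _ h0] by metis
      qed
    qed
  qed
  have "strict_mono (blowup l k g0 g)" "strict_mono (blowup c k h0 h)"
    using certificate_cell certificate by (auto intro!: strict_mono_blowup simp: certificate_cell_def certificate_def)
  moreover have "blowup l k g0 g 0 = 0" "blowup c k h0 h 0 = 0"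
    using certificate_cell certificate by (auto simp: blowup_def certificate_cell_def certificate_def)
  ultimately show ?thesis using main unfolding certificate_def by blast
qed

section \<open>A cell that beats the greedy strategy\<close>

text \<open>
  Found by computer search. Painter concedes paths in this order: in color 1 up to length 5, in
  color 2 length 1, in color 1 length 6, in color 2 length 2, in color 1 length 7, in color 2 up
  to length 5, and from then on in color 1. Each entry is the least size of a component in which
  Builder can force that length at that time.
\<close>

definition g_list :: "int list" where
  "g_list = [0, 1, 2, 3, 4, 5, 12, 19, 41, 42, 43, 44, 51, 58, 65, 72, 82, 83, 90, 97, 104, 111,
    118, 122, 129, 136, 143, 150, 157, 161, 168, 175, 182, 189, 196, 200, 207, 214, 221, 228,
    235, 239, 246, 253, 260, 267, 274, 278, 285, 292, 299, 306, 313, 317, 324, 331, 338, 345,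
    352, 356, 363, 370, 377, 384, 391, 395, 402, 409, 416, 423, 430, 434, 441, 448, 455, 462,
    469, 473, 480, 487, 494, 501, 508, 512, 519, 526, 533, 540]"

definition h_list :: "int list" where
  "h_list = [0, 6, 13, 20, 27, 34]"

text \<open>
  The lists \<open>g_sums_list\<close> and \<open>h_sums_list\<close> bound \<open>g i + g j\<close> and \<open>h i + h j\<close> from below in terms of \<open>i + j\<close>; their second
  parts cover the carries. The offsets satisfy \<open>1 + 513 + 33 = 547\<close>.
\<close>

definition g_sums_list0 :: "int list" where
  "g_sums_list0 = [0, 1, 2, 3, 4, 5, 6, 7, 8, 9, 10, 17, 24, 31, 38, 48, 49, 56, 63, 70, 77, 84, 88, 95, 102,
    109, 116, 123, 127, 134, 141, 148, 155, 162, 166, 173, 180, 187, 194, 201, 205, 212, 219, 226,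
    233, 240, 244, 251, 258, 265, 272, 279, 283, 290, 297, 304, 311, 318, 322, 329, 336, 343, 350,
    357, 361, 368, 375, 382, 389, 396, 400, 407, 414, 421, 428, 435, 439, 446, 453, 460, 467, 474,
    478, 485, 492, 499, 506]"

definition g_sums_list :: "int list" where
  "g_sums_list = g_sums_list0 @ map ((+) 513) g_list"

definition h_sums_list0 :: "int list" where
  "h_sums_list0 = [0, 6, 12, 19, 26]"

definition h_sums_list :: "int list" where
  "h_sums_list = h_sums_list0 @ map ((+) 33) h_list"

text \<open>The addition table of the two lists is compared row by row with \<open>ms\<close>
  shifted by the row index; \<open>list_all2\<close> also enforces that \<open>ms\<close> is long
  enough.\<close>

fun below_sums :: "int list \<Rightarrow> int list \<Rightarrow> int list \<Rightarrow> bool" where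
  "below_sums ms [] ys = True"
| "below_sums ms (x # xs) ys =
     (list_all2 (\<lambda>y m. m \<le> x + y) ys (take (length ys) ms) \<and> below_sums (tl ms) xs ys)"

lemma below_sumsD:
  "below_sums ms xs ys \<Longrightarrow> i < length xs \<Longrightarrow> j < length ys \<Longrightarrow> ms ! (i + j) \<le> xs ! i + ys ! j"
proof (induction xs arbitrary: ms i)
  case (Cons x xs)
  from Cons.prems(1) have l: "length ys \<le> length ms" by (auto dest: list_all2_lengthD)
  show ?case
  proof (cases i)
    case 0
    then show ?thesis using Cons.prems by (auto simp: list_all2_conv_all_nth)
  next
    case (Suc i')
    then have "ms ! (i + j) = tl ms ! (i' + j)" using l Cons.prems by (cases ms) auto
    then show ?thesis using Cons Suc by auto
  qed
qed simp

section \<open>Checks of the tables by evaluation\<close>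

lemma g_sums: "below_sums g_sums_list g_list g_list" by code_simp

lemma h_sums: "below_sums h_sums_list h_list h_list" by code_simp

lemma lists_sorted: "sorted_wrt (<) g_list" "sorted_wrt (<) h_list" by code_simp+

lemma lists_length: "length g_list = 88" "length g_sums_list0 = 87" "length h_list = 6" "length h_sums_list0 = 5" "length g_sums_list = 175" "length h_sums_list = 11"
  by code_simp+

lemma lists_bounds: "g_list ! 0 = 0" "h_list ! 0 = 0" "list_all (\<lambda>x. 0 \<le> x \<and> x < 547) g_list"
  "list_all (\<lambda>x. 0 \<le> x \<and> x < 547) h_list"
  by code_simp+

text \<open>With the tabulated lower bounds, the condition depends on the pieces only through
  \<open>m = r1 + r2\<close> and \<open>n = s1 + s2\<close>. Taking \<open>tl\<close> aligns length
  \<open>m + 1\<close> with the sum at \<open>m\<close>, and \<open>zip\<close> stops before the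
  carries.\<close>

lemma no_carry:
  "list_all (\<lambda>(x, m). list_all (\<lambda>(y, n). x \<le> 1 + m + n \<or> y \<le> 1 + m + n) (zip (tl h_list) h_sums_list)) (zip (tl g_list) g_sums_list)"
  by code_simp

text \<open>The constant 33 bounds from below the price of the pieces of color 2 once that color
  carries; 513 does the same for color 1 in \<open>h_no_carry\<close>.\<close>

lemma g_no_carry: "list_all (\<lambda>(x, m). x \<le> 1 + m + 33) (zip (tl g_list) g_sums_list)"
  by code_simp

lemma h_no_carry: "list_all (\<lambda>(y, n). y \<le> 1 + n + 513) (zip (tl h_list) h_sums_list)"
  by code_simp

definition g_cell :: "nat \<Rightarrow> nat" where
  "g_cell r = nat (g_list ! r)"

definition h_cell :: "nat \<Rightarrow> nat" where
  "h_cell s = nat (h_list ! s)"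

lemma int_g_cell: "r < 88 \<Longrightarrow> int (g_cell r) = g_list ! r" "r < 88 \<Longrightarrow> g_cell r < 547"
  using lists_bounds(3) lists_length by (auto simp: g_cell_def list_all_length)

lemma int_h_cell: "s < 6 \<Longrightarrow> int (h_cell s) = h_list ! s" "s < 6 \<Longrightarrow> h_cell s < 547"
  using lists_bounds(4) lists_length by (auto simp: h_cell_def list_all_length)

lemma certificate_cell_88_6: "certificate_cell 88 6 547 g_cell h_cell"
proof -
  have main: "let S = 1 + g_cell r1 + g_cell r2 + h_cell s1 + h_cell s2; r = r1 + r2 + 1; s = s1 + s2 + 1 in
        if r < 88 then if s < 6 then g_cell r \<le> S \<or> h_cell s \<le> S else g_cell r \<le> S
        else if s < 6 then h_cell s \<le> S else 547 + g_cell (r - 88) \<le> S \<and> 547 + h_cell (s - 6) \<le> S"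
    if r: "r1 < 88" "r2 < 88" and s: "s1 < 6" "s2 < 6" for r1 r2 s1 s2
  proof -
    let ?G = "int (g_cell r1) + int (g_cell r2)" and ?H = "int (h_cell s1) + int (h_cell s2)"
    define m n where "m = r1 + r2" and "n = s1 + s2"
    have G: "g_sums_list ! m \<le> ?G" and H: "h_sums_list ! n \<le> ?H"
      using below_sumsD[OF g_sums, of r1 r2] below_sumsD[OF h_sums, of s1 s2] r s
      by (auto simp: int_g_cell int_h_cell lists_length m_def n_def)
    have Gc: "513 + int (g_cell (m + 1 - 88)) \<le> ?G" if "\<not> m + 1 < 88"
    proof -
      \<comment> \<open>The carry part of the table starts at index 87, that is, where
        \<open>m + 1\<close> reaches 88.\<close>
      have "g_sums_list ! m = 513 + g_list ! (m - 87)" using that r lists_length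
        unfolding g_sums_list_def m_def by (simp add: nth_append)
      then show ?thesis using G that r by (simp add: int_g_cell m_def)
    qed
    have Hc: "33 + int (h_cell (n + 1 - 6)) \<le> ?H" if "\<not> n + 1 < 6"
    proof -
      have "h_sums_list ! n = 33 + h_list ! (n - 5)" using that s lists_length
        unfolding h_sums_list_def n_def by (simp add: nth_append)
      then show ?thesis using H that s by (simp add: int_h_cell n_def)
    qed
    have Gz: "int (g_cell (m + 1)) \<le> 1 + g_sums_list ! m + 33" if "m + 1 < 88"
      using g_no_carry that lists_length by (auto simp: int_g_cell list_all_length nth_tl)
    have Hz: "int (h_cell (n + 1)) \<le> 1 + h_sums_list ! n + 513" if "n + 1 < 6"
      using h_no_carry that lists_length by (auto simp: int_h_cell list_all_length nth_tl)
    have GHz: "int (g_cell (m + 1)) \<le> 1 + g_sums_list ! m + h_sums_list ! n \<or> int (h_cell (n + 1)) \<le> 1 + g_sums_list ! m + h_sums_list ! n"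
      if "m + 1 < 88" "n + 1 < 6"
      using no_carry that lists_length by (auto simp: int_g_cell int_h_cell list_all_length nth_tl)
    define S where "S = 1 + g_cell r1 + g_cell r2 + h_cell s1 + h_cell s2"
    have S: "int S = 1 + ?G + ?H" unfolding S_def by simp
    have "g_cell (m + 1) \<le> S \<or> h_cell (n + 1) \<le> S" if "m + 1 < 88" "n + 1 < 6"
      using GHz[OF that] G H S by linarith
    moreover have "g_cell (m + 1) \<le> S" if "m + 1 < 88" "\<not> n + 1 < 6"
      using Gz[OF that(1)] Hc[OF that(2)] G S by linarith
    moreover have "h_cell (n + 1) \<le> S" if "\<not> m + 1 < 88" "n + 1 < 6"
      using Gc[OF that(1)] Hz[OF that(2)] H S by linarith
    moreover have "547 + g_cell (m + 1 - 88) \<le> S \<and> 547 + h_cell (n + 1 - 6) \<le> S"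
      if "\<not> m + 1 < 88" "\<not> n + 1 < 6"
      using Gc[OF that(1)] Hc[OF that(2)] S by linarith
    ultimately show ?thesis
      unfolding Let_def m_def[symmetric] n_def[symmetric] S_def[symmetric] by presburger
  qed
  have mg: "g_cell r < g_cell r'" if "r < r'" "r' < 88" for r r'
  proof -
    have "g_list ! r < g_list ! r'"
      using lists_sorted(1) lists_length that unfolding sorted_wrt_iff_nth_less by simp
    then show ?thesis using int_g_cell(1)[of r] int_g_cell(1)[of r'] that by linarith
  qed
  have mh: "h_cell r < h_cell r'" if "r < r'" "r' < 6" for r r'
  proof -
    have "h_list ! r < h_list ! r'"
      using lists_sorted(2) lists_length that unfolding sorted_wrt_iff_nth_less by simp
    then show ?thesis using int_h_cell(1)[of r] int_h_cell(1)[of r'] that by linarith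
  qed
  have z: "g_cell 0 = 0" "h_cell 0 = 0"
    using lists_bounds by (auto simp: g_cell_def h_cell_def)
  show ?thesis unfolding certificate_cell_def
    by (intro conjI allI impI main z int_g_cell(2) int_h_cell(2) strict_mono_onI)
      (simp_all add: mg mh)
qed

text \<open>Two rounds with the colors exchanged make the scaling symmetric: both colors gain a
  length factor \<open>88 * 6 = 528\<close> and a price factor \<open>547 * 547\<close>.\<close>

lemma certificate_power:
  "\<exists>g h. certificate g h \<and> g (528 ^ n) = 547 ^ (2 * n) \<and> h (528 ^ n) = 547 ^ (2 * n)"
proof (induction n)
  case 0
  then show ?case using certificate_id by (intro exI[of _ "\<lambda>x. x"]) simp
next
  case (Suc n)
  then obtain g h where *: "certificate g h" "g (528 ^ n) = 547 ^ (2 * n)" "h (528 ^ n) = 547 ^ (2 * n)"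
    by blast
  define g' where "g' = blowup 6 547 h_cell (blowup 88 547 g_cell g)"
  define h' where "h' = blowup 88 547 g_cell (blowup 6 547 h_cell h)"
  have certificate: "certificate g' h'" unfolding g'_def h'_def
    by (intro certificate_blowup certificate_cell_88_6 certificate_cell_sym[OF certificate_cell_88_6] *)
  have scale: "blowup 88 547 g_cell f (88 * x) = 547 * f x" "blowup 6 547 h_cell f (6 * x) = 547 * f x" for f x
    using certificate_cell_88_6 by (simp_all add: blowup_def certificate_cell_def)
  have e1: "(528 :: nat) ^ Suc n = 6 * (88 * 528 ^ n)" and e2: "(528 :: nat) ^ Suc n = 88 * (6 * 528 ^ n)"
    by simp_all
  have "g' (528 ^ Suc n) = 547 ^ (2 * Suc n)"
    unfolding g'_def e1 scale *(2) by simp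
  moreover have "h' (528 ^ Suc n) = 547 ^ (2 * Suc n)"
    unfolding h'_def e2 scale *(3) by simp
  ultimately show ?case using certificate by blast
qed

section \<open>The strategy of Builder\<close>

fun three_pow_log2 :: "nat \<Rightarrow> nat" where
  "three_pow_log2 x = (if x \<le> 1 then 1 else 3 * three_pow_log2 (x div 2))"

declare three_pow_log2.simps [simp del]

lemma three_pow_log2_pos: "1 \<le> three_pow_log2 x"
proof (induction x rule: three_pow_log2.induct)
  case (1 x)
  then show ?case by (subst three_pow_log2.simps) auto
qed

lemma three_pow_log2_mono: "x \<le> y \<Longrightarrow> three_pow_log2 x \<le> three_pow_log2 y"
proof (induction y arbitrary: x rule: three_pow_log2.induct)
  case (1 y)
  show ?case
  proof (cases "x \<le> 1")
    case True
    then show ?thesis using three_pow_log2_pos[of y] by (simp add: three_pow_log2.simps[of x])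
  next
    case False
    then have "three_pow_log2 (x div 2) \<le> three_pow_log2 (y div 2)" using 1 by (simp add: div_le_mono)
    then show ?thesis using False 1(2) by (simp add: three_pow_log2.simps[of x] three_pow_log2.simps[of y])
  qed
qed

section \<open>Positions from which Builder wins\<close>

lemma builder_forces_Suc: "builder_forces r F k n G col \<Longrightarrow> builder_forces r F k (Suc n) G col"
proof (induction n arbitrary: G col)
  case (Suc n)
  then show ?case unfolding builder_forces.simps(2)[of r F k n] builder_forces.simps(2)[of r F k "Suc n"] by blast
qed simp

lemma builder_forces_mono: "n \<le> m \<Longrightarrow> builder_forces r F k n G col \<Longrightarrow> builder_forces r F k m G col"
  by (induction rule: dec_induct) (auto simp del: builder_forces.simps intro: builder_forces_Suc)

definition winning :: "nat \<Rightarrow> nat \<Rightarrow> nat graph \<Rightarrow> (nat \<Rightarrow> nat) \<Rightarrow> bool" where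
  "winning l k G col \<longleftrightarrow> (\<exists>n. builder_forces 2 (\<lambda>_. path_graph l) k n G col)"

lemma winning_lost: "painter_lost 2 (\<lambda>_. path_graph l) G col \<Longrightarrow> winning l k G col"
  unfolding winning_def by (rule exI[of _ 0]) simp

lemma winning_move:
  assumes "legal_move k G v N" "winning l k (add_vertex G v N) (col(v := 1))"
    "winning l k (add_vertex G v N) (col(v := 2))"
  shows "winning l k G col"
proof -
  obtain n1 n2 where
    "builder_forces 2 (\<lambda>_. path_graph l) k n1 (add_vertex G v N) (col(v := 1))"
    "builder_forces 2 (\<lambda>_. path_graph l) k n2 (add_vertex G v N) (col(v := 2))"
    using assms unfolding winning_def by blast
  then have "builder_forces 2 (\<lambda>_. path_graph l) k (max n1 n2) (add_vertex G v N) (col(v := 1))"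
    "builder_forces 2 (\<lambda>_. path_graph l) k (max n1 n2) (add_vertex G v N) (col(v := 2))"
    by (auto elim!: builder_forces_mono[rotated])
  moreover have "{1..2} = {1, 2 :: nat}" by auto
  ultimately have "builder_forces 2 (\<lambda>_. path_graph l) k (Suc (max n1 n2)) G col"
    using assms(1) by auto
  then show ?thesis unfolding winning_def by blast
qed

text \<open>Components rather than paths are counted, since joining a piece uses up its whole
  component.\<close>

definition stock :: "nat graph \<Rightarrow> (nat \<Rightarrow> nat) \<Rightarrow> nat \<times> nat \<times> nat \<Rightarrow> nat set set" where
  "stock G col = (\<lambda>(s, a, t). {C \<in> components G. card C \<le> t \<and>
     (\<exists>p. mono_path G col s p \<and> p \<noteq> [] \<and> length p = a \<and> set p \<subseteq> C)})"

lemma finite_stock: "simple_graph G \<Longrightarrow> finite (stock G col x)"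
  by (auto simp: stock_def components_eq simple_graph_def split: prod.split)

lemma mono_path_add_vertex:
  assumes "v \<notin> verts G" "mono_path G col s p"
  shows "mono_path (add_vertex G v N) (col(v := c)) s p"
  using assms by (auto simp: mono_path_def add_vertex_def elim!: successively_mono)

text \<open>A piece of length 0 is the empty path and takes no component.\<close>

definition cost :: "nat \<times> nat \<times> nat \<Rightarrow> nat" where
  "cost = (\<lambda>(s, a, t). if a = 0 then 0 else t)"

text \<open>Greedy choice: fewer than \<open>length L\<close> components are in use when a piece is
  taken, so its stock still offers a fresh one outside the reserved set \<open>Q\<close>. Fresh
  components make the pieces disjoint and the move acyclic.\<close>

lemma select_pieces:
  assumes G: "simple_graph G"
    and "\<And>s a t. (s, a, t) \<in> set L \<Longrightarrow> 0 < a \<Longrightarrow> length L \<le> card (stock G col (s, a, t) - Q)"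
  shows "\<exists>ps N. list_all2 (\<lambda>(s, a, t) p. length p = a \<and> (p \<noteq> [] \<longrightarrow> mono_path G col s p \<and> last p \<in> N)) L ps \<and>
     sorted_wrt (\<lambda>p q. set p \<inter> set q = {}) ps \<and> N \<subseteq> verts G \<and> finite N \<and> card N \<le> length L \<and>
     (\<forall>u\<in>N. comp_of G u \<notin> Q) \<and> (\<forall>u\<in>N. \<forall>w\<in>N. w \<in> comp_of G u \<longrightarrow> u = w) \<and>
     (\<Sum>u\<in>N. card (comp_of G u)) \<le> sum_list (map cost L)"
  using assms(2)
proof (induction L)
  case Nil
  show ?case by (intro exI[of _ "[]"] exI[of _ "{}"]) simp
next
  case (Cons x L)
  obtain s a t where x: "x = (s, a, t)" by (cases x)
  have "\<exists>ps N. list_all2 (\<lambda>(s, a, t) p. length p = a \<and> (p \<noteq> [] \<longrightarrow> mono_path G col s p \<and> last p \<in> N)) L ps \<and>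
     sorted_wrt (\<lambda>p q. set p \<inter> set q = {}) ps \<and> N \<subseteq> verts G \<and> finite N \<and> card N \<le> length L \<and>
     (\<forall>u\<in>N. comp_of G u \<notin> Q) \<and> (\<forall>u\<in>N. \<forall>w\<in>N. w \<in> comp_of G u \<longrightarrow> u = w) \<and>
     (\<Sum>u\<in>N. card (comp_of G u)) \<le> sum_list (map cost L)"
  proof (rule Cons.IH)
    fix s a t assume "(s, a, t) \<in> set L" "0 < a"
    then have "length (x # L) \<le> card (stock G col (s, a, t) - Q)" by (intro Cons.prems) auto
    then show "length L \<le> card (stock G col (s, a, t) - Q)" by simp
  qed
  then obtain ps N where
    ps: "list_all2 (\<lambda>(s, a, t) p. length p = a \<and> (p \<noteq> [] \<longrightarrow> mono_path G col s p \<and> last p \<in> N)) L ps"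
      "sorted_wrt (\<lambda>p q. set p \<inter> set q = {}) ps"
    and N: "N \<subseteq> verts G" "finite N" "card N \<le> length L" "\<forall>u\<in>N. comp_of G u \<notin> Q"
      "\<forall>u\<in>N. \<forall>w\<in>N. w \<in> comp_of G u \<longrightarrow> u = w" "(\<Sum>u\<in>N. card (comp_of G u)) \<le> sum_list (map cost L)"
    by blast
  show ?case
  proof (cases "a = 0")
    case True
    then show ?thesis using ps N x
      by (intro exI[of _ "[] # ps"] exI[of _ N]) (auto simp: cost_def)
  next
    case False
    have "card (comp_of G ` N) < card (stock G col x - Q)"
      using card_image_le[OF N(2), of "comp_of G"] N(3) Cons.prems[of s a t] False x by simp
    then have "\<not> stock G col x - Q \<subseteq> comp_of G ` N"
      using card_mono[of "comp_of G ` N"] N(2) by (meson finite_imageI not_le)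
    then obtain C where C: "C \<in> stock G col x" "C \<notin> Q" "C \<notin> comp_of G ` N" by blast
    then obtain p where p: "mono_path G col s p" "p \<noteq> []" "length p = a" "set p \<subseteq> C"
      and C': "C \<in> components G" "card C \<le> t"
      by (auto simp: stock_def x)
    obtain y where y: "C = comp_of G y" using C' by (auto simp: components_eq)
    let ?u = "last p"
    have u: "?u \<in> verts G" "?u \<in> C" using p mono_path_verts[OF p(1)] by auto
    have Cu: "C = comp_of G ?u" using comp_of_eq u(2) y by metis
    have new: "comp_of G w \<inter> C = {}" if "w \<in> N" for w
    proof -
      have "w \<notin> C"
      proof
        assume "w \<in> C"
        then have "comp_of G w = C" using y comp_of_eq by metis
        then show False using C(3) that by blast
      qed
      then show ?thesis unfolding y by (rule comp_of_disjoint)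
    qed
    have "?u \<notin> N" using new[of ?u] Cu u(2) by blast
    have dis: "set p \<inter> set q = {}" if q: "q \<in> set ps" for q
    proof (cases "q = []")
      case False
      obtain i where i: "i < length ps" "ps ! i = q" using q by (auto simp: in_set_conv_nth)
      obtain s' a' t' where "L ! i = (s', a', t')" by (cases "L ! i")
      then have q': "mono_path G col s' q" "last q \<in> N"
        using list_all2_nthD2[OF ps(1) i(1)] i(2) False by auto
      have "set q \<subseteq> comp_of G (last q)"
        using walk_connected[OF G, of q "last q"] q'(1) False by (auto simp: mono_path_def)
      then show ?thesis using new[OF q'(2)] p(4) by blast
    qed simp
    have "list_all2 (\<lambda>(s, a, t) p. length p = a \<and> (p \<noteq> [] \<longrightarrow> mono_path G col s p \<and> last p \<in> insert ?u N)) (x # L) (p # ps)"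
      using ps(1) p x by (auto elim!: list_all2_mono)
    moreover have "sorted_wrt (\<lambda>p q. set p \<inter> set q = {}) (p # ps)" using ps(2) dis by simp
    moreover have "\<forall>z\<in>insert ?u N. \<forall>w\<in>insert ?u N. w \<in> comp_of G z \<longrightarrow> z = w"
    proof (intro ballI impI)
      fix z w assume zw: "z \<in> insert ?u N" "w \<in> insert ?u N" "w \<in> comp_of G z"
      have "w \<notin> N" if "z = ?u" using new[of w] zw(3) Cu that comp_of_self[of w G] by blast
      moreover have "z \<notin> N" if "w = ?u" using new[of z] zw(3) u(2) that by blast
      ultimately show "z = w" using zw N(5) by blast
    qed
    moreover have "(\<Sum>z\<in>insert ?u N. card (comp_of G z)) \<le> sum_list (map cost (x # L))"
      using N(2,6) \<open>?u \<notin> N\<close> C'(2) Cu False by (simp add: cost_def x)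
    moreover have "card (insert ?u N) \<le> length (x # L)" using N(2,3) \<open>?u \<notin> N\<close> by simp
    moreover have "\<forall>z\<in>insert ?u N. comp_of G z \<notin> Q" using N(4) C(2) Cu by blast
    ultimately show ?thesis using N(1,2) u by (intro exI[of _ "p # ps"] exI[of _ "insert ?u N"]) simp
  qed
qed

definition legal_board :: "nat \<Rightarrow> nat graph \<Rightarrow> bool" where
  "legal_board k G \<longleftrightarrow> forest G \<and> (\<forall>C\<in>components G. card C \<le> k)"

text \<open>Both pieces are attached at their last vertex, so the second one is traversed
  backwards.\<close>

lemma mono_path_join:
  assumes G: "simple_graph G" "v \<notin> verts G" "N \<subseteq> verts G"
    and p: "mono_path G col s p" "p \<noteq> [] \<Longrightarrow> last p \<in> N"
    and q: "mono_path G col s q" "q \<noteq> [] \<Longrightarrow> last q \<in> N" and dis: "set p \<inter> set q = {}"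
  shows "mono_path (add_vertex G v N) (col(v := s)) s (p @ v # rev q)"
proof -
  have v: "v \<notin> set p" "v \<notin> set q" using p(1) q(1) G(2) by (auto simp: mono_path_def)
  note p' = mono_path_add_vertex[OF G(2) p(1), where N = N and c = s]
  note q' = mono_path_add_vertex[OF G(2) q(1), where N = N and c = s]
  have "walk (add_vertex G v N) (rev q)" using q' by (simp add: mono_path_def insert_commute)
  then have "walk (add_vertex G v N) (p @ v # rev q)"
    using p' p(2) q(2) by (auto simp: mono_path_def successively_append_iff successively_Cons hd_rev
      edges_add_vertex[OF G])
  then show ?thesis using p' q' v dis by (auto simp: mono_path_def add_vertex_def)
qed

lemma stock_add_vertex:
  assumes G: "simple_graph G" "v \<notin> verts G" "N \<subseteq> verts G"
    and C: "C \<in> stock G col x" "C \<inter> N = {}"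
  shows "C \<in> stock (add_vertex G v N) (col(v := c)) x"
  using C mono_path_add_vertex[OF G(2)]
  by (fastforce simp: stock_def components_add_vertex[OF G] split: prod.splits)

text \<open>One move serves both answers: the new vertex is linked to up to two pieces of each
  color, and those of the color that Painter picks merge.\<close>

lemma join_pieces:
  assumes board: "legal_board k G"
    and L: "L = [(1, a1, t1), (1, a2, t2), (2, b1, u1), (2, b2, u2)]"
    and avail: "\<And>s a t. (s, a, t) \<in> set L \<Longrightarrow> 0 < a \<Longrightarrow> 4 \<le> card (stock G col (s, a, t) - Q)"
    and m: "1 + sum_list (map cost L) \<le> m" "m \<le> k"
  shows "\<exists>v N. legal_move k G v N \<and> finite N \<and> card N \<le> 4 \<and> (\<forall>u\<in>N. comp_of G u \<notin> Q) \<and>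
      comp_of (add_vertex G v N) v \<in> stock (add_vertex G v N) (col(v := 1)) (1, a1 + a2 + 1, m) \<and>
      comp_of (add_vertex G v N) v \<in> stock (add_vertex G v N) (col(v := 2)) (2, b1 + b2 + 1, m)"
proof -
  have simple: "simple_graph G" using board by (auto simp: legal_board_def forest_def)
  obtain v where v: "v \<notin> verts G"
    using simple ex_new_if_finite[OF infinite_UNIV_nat] by (auto simp: simple_graph_def)
  have "length L \<le> card (stock G col (s, a, t) - Q)" if "(s, a, t) \<in> set L" "0 < a" for s a t
    using avail[OF that] by (simp add: L)
  from select_pieces[OF simple this] obtain ps N where
    ps: "list_all2 (\<lambda>(s, a, t) p. length p = a \<and> (p \<noteq> [] \<longrightarrow> mono_path G col s p \<and> last p \<in> N)) L ps"
      "sorted_wrt (\<lambda>p q. set p \<inter> set q = {}) ps"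
    and N: "N \<subseteq> verts G" "finite N" "card N \<le> length L" "\<forall>u\<in>N. comp_of G u \<notin> Q"
      "\<forall>u\<in>N. \<forall>w\<in>N. w \<in> comp_of G u \<longrightarrow> u = w" "(\<Sum>u\<in>N. card (comp_of G u)) \<le> sum_list (map cost L)"
    by blast
  let ?G = "add_vertex G v N"
  note new = simple v N(1)
  have sep: "\<And>u w. u \<in> N \<Longrightarrow> w \<in> N \<Longrightarrow> w \<in> comp_of G u \<Longrightarrow> u = w" using N(5) by blast
  have cardv: "card (comp_of ?G v) \<le> m"
    using card_comp_of_new[OF new sep] N(6) m(1) by simp
  have comps: "components ?G = insert (comp_of ?G v) {C \<in> components G. C \<inter> N = {}}"
    unfolding components_add_vertex[OF new] comp_of_new[OF new] ..
  have legal: "legal_move k G v N"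
    unfolding legal_move_def comps
    using v N(1) cardv m(2) board forest_add_vertex[OF new _ sep] by (auto simp: legal_board_def)
  obtain p1 p2 q1 q2 where P: "ps = [p1, p2, q1, q2]"
    using ps(1) unfolding L by (auto simp: list_all2_Cons1)
  have stock: "comp_of ?G v \<in> stock ?G (col(v := s)) (s, length p + length q + 1, m)"
    if p: "p \<noteq> [] \<longrightarrow> mono_path G col s p \<and> last p \<in> N" "q \<noteq> [] \<longrightarrow> mono_path G col s q \<and> last q \<in> N"
      and dis: "set p \<inter> set q = {}" for p q s
  proof -
    have "mono_path G col s p" "mono_path G col s q" using p by (auto simp: mono_path_def)
    then have path: "mono_path ?G (col(v := s)) s (p @ v # rev q)"
      using p dis by (intro mono_path_join[OF new]) auto
    then have "set (p @ v # rev q) \<subseteq> comp_of ?G v"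
      using walk_connected[OF simple_add_vertex[OF new], of "p @ v # rev q" v] by (auto simp: mono_path_def)
    then show ?thesis unfolding stock_def using path cardv comps
      by (auto intro!: exI[of _ "p @ v # rev q"])
  qed
  have "comp_of ?G v \<in> stock ?G (col(v := 1)) (1, a1 + a2 + 1, m)"
    using stock[of p1 1 p2] ps unfolding P L by auto
  moreover have "comp_of ?G v \<in> stock ?G (col(v := 2)) (2, b1 + b2 + 1, m)"
    using stock[of q1 2 q2] ps unfolding P L by auto
  ultimately show ?thesis using legal N(2-4) L by (intro exI[of _ v] exI[of _ N]) simp
qed

text \<open>Pigeonhole on repeated joins. \<open>Q1\<close> and \<open>Q2\<close> hold reserved
  components already produced; every round enlarges one of them and uses up at most four others, so
  \<open>n\<close> rounds leave at least \<open>M\<close> of each label.\<close>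

lemma repeat_join:
  assumes L: "L = [(1, a1, t1), (1, a2, t2), (2, b1, u1), (2, b2, u2)]"
    and Lab: "\<And>s a t. (s, a, t) \<in> set L \<Longrightarrow> 0 < a \<Longrightarrow> (s, a, t) \<in> Lab"
    and m: "1 + sum_list (map cost L) \<le> m" "m \<le> k"
    and goal: "\<And>G col. legal_board k G \<Longrightarrow> \<forall>x\<in>Lab. M \<le> card (stock G col x) \<Longrightarrow>
        M1 \<le> card (stock G col (1, a1 + a2 + 1, m)) \<or> M2 \<le> card (stock G col (2, b1 + b2 + 1, m)) \<Longrightarrow>
        winning l k G col"
  shows "legal_board k G \<Longrightarrow> Q1 \<subseteq> stock G col (1, a1 + a2 + 1, m) \<Longrightarrow> Q2 \<subseteq> stock G col (2, b1 + b2 + 1, m) \<Longrightarrow>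
    \<forall>x\<in>Lab. M + 4 * n \<le> card (stock G col x - (Q1 \<union> Q2)) \<Longrightarrow> M1 + M2 \<le> card Q1 + card Q2 + n \<Longrightarrow>
    winning l k G col"
proof (induction n arbitrary: G col Q1 Q2)
  case 0
  have simple: "simple_graph G" using 0 by (auto simp: legal_board_def forest_def)
  note fin = finite_stock[OF simple]
  have "M \<le> card (stock G col x)" if "x \<in> Lab" for x
    using 0(4) that card_mono[OF fin Diff_subset, of col x "Q1 \<union> Q2"] by fastforce
  moreover have "card Q1 \<le> card (stock G col (1, a1 + a2 + 1, m))" "card Q2 \<le> card (stock G col (2, b1 + b2 + 1, m))"
    using 0(2,3) fin by (auto intro: card_mono)
  then have "M1 \<le> card (stock G col (1, a1 + a2 + 1, m)) \<or> M2 \<le> card (stock G col (2, b1 + b2 + 1, m))"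
    using 0(5) by linarith
  ultimately show ?case using goal 0(1) by blast
next
  case (Suc n)
  have simple: "simple_graph G" using Suc.prems by (auto simp: legal_board_def forest_def)
  note fin = finite_stock[OF simple]
  let ?Q = "Q1 \<union> Q2"
  have "4 \<le> card (stock G col (s, a, t) - ?Q)" if "(s, a, t) \<in> set L" "0 < a" for s a t
    using Suc.prems(4) Lab[OF that] by fastforce
  from join_pieces[OF Suc.prems(1) L this m] obtain v N where
    vN: "legal_move k G v N" "finite N" "card N \<le> 4" "\<forall>u\<in>N. comp_of G u \<notin> ?Q"
    and new1: "comp_of (add_vertex G v N) v \<in> stock (add_vertex G v N) (col(v := 1)) (1, a1 + a2 + 1, m)"
    and new2: "comp_of (add_vertex G v N) v \<in> stock (add_vertex G v N) (col(v := 2)) (2, b1 + b2 + 1, m)"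
    by blast
  let ?G = "add_vertex G v N" and ?C = "comp_of (add_vertex G v N) v"
  have v: "v \<notin> verts G" "N \<subseteq> verts G" using vN(1) by (auto simp: legal_move_def)
  have board: "legal_board k ?G" using vN(1) by (auto simp: legal_move_def legal_board_def)
  have avoid: "C \<inter> N = {}" if C: "C \<in> components G" "C \<notin> comp_of G ` N" for C
  proof (rule ccontr)
    assume "C \<inter> N \<noteq> {}"
    then obtain u where "u \<in> C" "u \<in> N" by blast
    moreover obtain y where "C = comp_of G y" using C by (auto simp: components_eq)
    ultimately have "C = comp_of G u" using comp_of_eq by metis
    then show False using C(2) \<open>u \<in> N\<close> by blast
  qed
  have comp: "C \<in> components G" if "C \<in> stock G col x" for C x
    using that by (auto simp: stock_def split: prod.splits)
  \<comment> \<open>The new component contains \<open>v\<close>, hence differs from all old ones and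
    really enlarges \<open>Q1\<close> or \<open>Q2\<close>.\<close>
  have Cnew: "?C \<notin> components G"
  proof
    assume "?C \<in> components G"
    then obtain y where "y \<in> verts G" "?C = comp_of G y" by (auto simp: components_eq)
    then have "v \<in> comp_of G y" by (metis comp_of_self)
    then show False using comp_of_verts[OF simple \<open>y \<in> verts G\<close>] v by blast
  qed
  have keep: "C \<in> stock ?G (col(v := c)) x" if "C \<in> stock G col x" "C \<notin> comp_of G ` N" for C x c
    using stock_add_vertex[OF simple v that(1)] avoid[OF comp[OF that(1)] that(2)] by blast
  have keepQ: "Q1 \<subseteq> stock ?G (col(v := c)) (1, a1 + a2 + 1, m)" "Q2 \<subseteq> stock ?G (col(v := c)) (2, b1 + b2 + 1, m)" for c
    using Suc.prems(2,3) keep vN(4) by blast+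
  have CQ: "?C \<notin> ?Q" using Cnew Suc.prems(2,3) comp by blast
  have finQ: "finite Q1" "finite Q2" using Suc.prems(2,3) fin finite_subset by blast+
  have rest: "M + 4 * n \<le> card (stock ?G (col(v := c)) x - insert ?C ?Q)" if x: "x \<in> Lab" for x c
  proof -
    have "M + 4 * n + 4 \<le> card (stock G col x - ?Q)" using Suc.prems(4) x by fastforce
    moreover have "card (stock G col x - ?Q) - card (comp_of G ` N) \<le> card (stock G col x - ?Q - comp_of G ` N)"
      using vN(2) by (intro diff_card_le_card_Diff) auto
    moreover have "card (comp_of G ` N) \<le> 4" using card_image_le[OF vN(2), of "comp_of G"] vN(3) by linarith
    moreover have "stock G col x - ?Q - comp_of G ` N \<subseteq> stock ?G (col(v := c)) x - insert ?C ?Q"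
      using keep Cnew comp by blast
    then have "card (stock G col x - ?Q - comp_of G ` N) \<le> card (stock ?G (col(v := c)) x - insert ?C ?Q)"
      using finite_stock[OF simple_add_vertex[OF simple v]] by (intro card_mono) auto
    ultimately show ?thesis by linarith
  qed
  show ?case
  proof (rule winning_move[OF vN(1)])
    show "winning l k ?G (col(v := 1))"
    proof (rule Suc.IH[OF board, of "insert ?C Q1" _ Q2])
      show "insert ?C Q1 \<subseteq> stock ?G (col(v := 1)) (1, a1 + a2 + 1, m)" using keepQ new1 by blast
      show "Q2 \<subseteq> stock ?G (col(v := 1)) (2, b1 + b2 + 1, m)" using keepQ by blast
      show "\<forall>x\<in>Lab. M + 4 * n \<le> card (stock ?G (col(v := 1)) x - (insert ?C Q1 \<union> Q2))"
        using rest by simp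
      show "M1 + M2 \<le> card (insert ?C Q1) + card Q2 + n" using Suc.prems(5) CQ finQ by simp
    qed
    show "winning l k ?G (col(v := 2))"
    proof (rule Suc.IH[OF board, of Q1 _ "insert ?C Q2"])
      show "insert ?C Q2 \<subseteq> stock ?G (col(v := 2)) (2, b1 + b2 + 1, m)" using keepQ new2 by blast
      show "Q1 \<subseteq> stock ?G (col(v := 2)) (1, a1 + a2 + 1, m)" using keepQ by blast
      show "\<forall>x\<in>Lab. M + 4 * n \<le> card (stock ?G (col(v := 2)) x - (Q1 \<union> insert ?C Q2))"
        using rest by simp
      show "M1 + M2 \<le> card Q1 + card (insert ?C Q2) + n" using Suc.prems(5) CQ finQ by simp
    qed
  qed
qed

section \<open>Sizes of the pieces along the order of concessions\<close>

definition labels :: "nat \<Rightarrow> nat \<Rightarrow> (nat \<Rightarrow> nat) \<Rightarrow> (nat \<Rightarrow> nat) \<Rightarrow> (nat \<times> nat \<times> nat) set" where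
  "labels A B g h = {(1, a, g a) |a. 1 \<le> a \<and> a < A} \<union> {(2, b, h b) |b. 1 \<le> b \<and> b < B}"

text \<open>
  The number \<open>b\<close> below is the first length not yet conceded in color 2 at the time when length \<open>x\<close>
  was conceded in color 1.
\<close>

definition bounded_walk :: "nat \<Rightarrow> nat \<Rightarrow> (nat \<Rightarrow> nat) \<Rightarrow> (nat \<Rightarrow> nat) \<Rightarrow> bool" where
  "bounded_walk A B g h \<longleftrightarrow>
     (\<forall>x. 1 \<le> x \<and> x < A \<longrightarrow> (\<exists>b. 1 \<le> b \<and> b \<le> B \<and> g x \<le> b * three_pow_log2 x \<and> (1 < x \<longrightarrow> g (x - 1) \<le> b * three_pow_log2 x) \<and>
        (1 < b \<longrightarrow> h (b - 1) \<le> (b - 1) * three_pow_log2 x))) \<and>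
     (\<forall>y. 1 \<le> y \<and> y < B \<longrightarrow> h y \<le> y * three_pow_log2 A)"

text \<open>For the new length \<open>A\<close> the witness is \<open>B\<close> itself; its bound on
  \<open>h\<close> is the last clause of \<open>bounded_walk\<close> at
  \<open>B - 1\<close>.\<close>

lemma bounded_walk_right:
  assumes "bounded_walk A B g h" "1 \<le> B"
  shows "bounded_walk (A + 1) B (g(A := B * three_pow_log2 A)) h"
  unfolding bounded_walk_def
proof (intro conjI allI impI)
  fix x assume x: "1 \<le> x \<and> x < A + 1"
  show "\<exists>b. 1 \<le> b \<and> b \<le> B \<and> (g(A := B * three_pow_log2 A)) x \<le> b * three_pow_log2 x \<and> (1 < x \<longrightarrow> (g(A := B * three_pow_log2 A)) (x - 1) \<le> b * three_pow_log2 x) \<and>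
        (1 < b \<longrightarrow> h (b - 1) \<le> (b - 1) * three_pow_log2 x)"
  proof (cases "x = A")
    case True
    have "g (A - 1) \<le> B * three_pow_log2 A" if A: "1 < A"
    proof -
      obtain b where b: "b \<le> B" "g (A - 1) \<le> b * three_pow_log2 (A - 1)"
        using assms(1) A unfolding bounded_walk_def by (metis One_nat_def Suc_leI diff_less zero_less_diff zero_less_one less_trans)
      note b(2)
      also have "b * three_pow_log2 (A - 1) \<le> B * three_pow_log2 A" using b(1) three_pow_log2_mono[of "A - 1" A] by (intro mult_le_mono) auto
      finally show ?thesis .
    qed
    then show ?thesis using True x assms unfolding bounded_walk_def by (intro exI[of _ B]) auto
  next
    case False
    then have "1 \<le> x \<and> x < A" "x - 1 \<noteq> A" "x \<noteq> A" using x by auto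
    then show ?thesis using assms(1) unfolding bounded_walk_def fun_upd_def by simp
  qed
next
  fix y assume "1 \<le> y \<and> y < B"
  then have "h y \<le> y * three_pow_log2 A" using assms(1) unfolding bounded_walk_def by blast
  also have "\<dots> \<le> y * three_pow_log2 (A + 1)" using three_pow_log2_mono[of A "A + 1"] by simp
  finally show "h y \<le> y * three_pow_log2 (A + 1)" .
qed

text \<open>The earlier witnesses survive because they only look at \<open>h\<close> below
  \<open>B\<close>.\<close>

lemma bounded_walk_up:
  assumes "bounded_walk A B g h" "1 \<le> B"
  shows "bounded_walk A (B + 1) g (h(B := B * three_pow_log2 A))"
  unfolding bounded_walk_def
proof (intro conjI allI impI)
  fix x assume "1 \<le> x \<and> x < A"
  then obtain b where b: "1 \<le> b" "b \<le> B" "g x \<le> b * three_pow_log2 x" "1 < x \<longrightarrow> g (x - 1) \<le> b * three_pow_log2 x"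
     "1 < b \<longrightarrow> h (b - 1) \<le> (b - 1) * three_pow_log2 x"
    using assms(1) unfolding bounded_walk_def by blast
  then show "\<exists>b. 1 \<le> b \<and> b \<le> B + 1 \<and> g x \<le> b * three_pow_log2 x \<and> (1 < x \<longrightarrow> g (x - 1) \<le> b * three_pow_log2 x) \<and>
        (1 < b \<longrightarrow> (h(B := B * three_pow_log2 A)) (b - 1) \<le> (b - 1) * three_pow_log2 x)"
    by (intro exI[of _ b]) auto
next
  fix y assume "1 \<le> y \<and> y < B + 1"
  then show "(h(B := B * three_pow_log2 A)) y \<le> y * three_pow_log2 A"
    using assms unfolding bounded_walk_def by (cases "y = B") auto
qed

text \<open>Let \<open>w = three_pow_log2 (A div 2)\<close> and let \<open>b\<close> be the witness
  for \<open>A div 2\<close>. The pieces cost at most \<open>b * w\<close> twice,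
  \<open>(b - 1) * w\<close> and \<open>(B - b) * (3 * w)\<close>. Together with at most
  \<open>w\<close> for the new vertex this is \<open>B * (3 * w)\<close>, whence the factor 3 per
  halving.\<close>

lemma bounded_walk_pieces:
  assumes walk: "bounded_walk A B g h" and AB: "1 \<le> A" "1 \<le> B"
  obtains a1 a2 b1 b2 where "a1 + a2 + 1 = A" "b1 + b2 + 1 = B"
    "1 + sum_list (map cost [(1, a1, g a1), (1, a2, g a2), (2, b1, h b1), (2, b2, h b2)]) \<le> B * three_pow_log2 A"
proof (cases "A = 1")
  case True
  \<comment> \<open>A single vertex of color 1 needs no pieces, so only a path on
    \<open>B - 1\<close> vertices of color 2 is extended.\<close>
  have "h (B - 1) \<le> B - 1" if "1 < B"
    using walk that three_pow_log2.simps[of 1] True unfolding bounded_walk_def by auto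
  then have "1 + sum_list (map cost [(1, 0, g 0), (1, 0, g 0), (2, 0, h 0), (2, B - 1, h (B - 1))]) \<le> B * three_pow_log2 A"
    using AB(2) True three_pow_log2.simps[of 1] by (auto simp: cost_def)
  then show ?thesis using True AB by (intro that[of 0 0 0 "B - 1"]) auto
next
  case False
  define a where "a = A div 2"
  have a: "1 \<le> a" "a < A" using False AB by (auto simp: a_def)
  have w: "three_pow_log2 A = 3 * three_pow_log2 a" using False AB unfolding a_def by (subst three_pow_log2.simps) simp
  obtain b where b: "1 \<le> b" "b \<le> B" "g a \<le> b * three_pow_log2 a" "1 < a \<Longrightarrow> g (a - 1) \<le> b * three_pow_log2 a"
     "1 < b \<Longrightarrow> h (b - 1) \<le> (b - 1) * three_pow_log2 a"
    using walk a unfolding bounded_walk_def by blast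
  define a' where "a' = A - 1 - a"
  \<comment> \<open>For even \<open>A\<close> the second half is shorter by one, which is why
    \<open>bounded_walk\<close> also controls \<open>g (x - 1)\<close>.\<close>
  have a': "a' = a \<or> a' = a - 1" "a + a' + 1 = A" using a unfolding a'_def a_def by presburger+
  have 1: "cost (1, a, g a) \<le> b * three_pow_log2 a" using b(3) by (simp add: cost_def)
  have 2: "cost (1, a', g a') \<le> b * three_pow_log2 a" using b(3,4) a' by (cases "a' = 0") (auto simp: cost_def)
  have 3: "cost (2, b - 1, h (b - 1)) \<le> (b - 1) * three_pow_log2 a" using b(5) by (cases "b = 1") (auto simp: cost_def)
  have 4: "cost (2, B - b, h (B - b)) \<le> (B - b) * three_pow_log2 A"
    using walk b(1,2) AB unfolding bounded_walk_def by (cases "B = b") (auto simp: cost_def)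
  have "1 + sum_list (map cost [(1, a, g a), (1, a', g a'), (2, b - 1, h (b - 1)), (2, B - b, h (B - b))])
     \<le> three_pow_log2 a + (2 * (b * three_pow_log2 a) + (b - 1) * three_pow_log2 a + (B - b) * three_pow_log2 A)"
    using 1 2 3 4 three_pow_log2_pos[of a] by simp
  also have "\<dots> = B * three_pow_log2 A"
  proof -
    obtain c d where "b = Suc c" "B = b + d" using b(1,2) by (metis Suc_le_D One_nat_def le_Suc_ex)
    then show ?thesis unfolding w by (simp add: algebra_simps)
  qed
  finally show ?thesis using a' b(1,2) by (intro that[of a a' "b - 1" "B - b"]) auto
qed

text \<open>Induction on the lengths still to be conceded: joining produces many copies of the next
  length in one of the colors while enough of the older stock remains.\<close>

lemma builder_walk:
  assumes l: "1 \<le> l"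
  shows "bounded_walk A B g h \<Longrightarrow> 1 \<le> A \<Longrightarrow> A \<le> l + 1 \<Longrightarrow> 1 \<le> B \<Longrightarrow> B \<le> l + 1 \<Longrightarrow>
    \<exists>M. \<forall>G col. legal_board (l * three_pow_log2 l) G \<and> (\<forall>x\<in>labels A B g h. M \<le> card (stock G col x)) \<longrightarrow> winning l (l * three_pow_log2 l) G col"
proof (induction "(l + 1 - A) + (l + 1 - B)" arbitrary: A B g h rule: less_induct)
  case less
  let ?k = "l * three_pow_log2 l"
  have lost: "winning l ?k G col" if G: "(s, l, t) \<in> labels A B g h" "\<forall>x\<in>labels A B g h. 1 \<le> card (stock G col x)" for G col s t
  proof -
    have "card (stock G col (s, l, t)) \<noteq> 0" using G by fastforce
    then have "stock G col (s, l, t) \<noteq> {}" by auto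
    then obtain p where "mono_path G col s p" "length p = l" by (auto simp: stock_def)
    moreover have "s \<in> {1..2}" using G(1) by (auto simp: labels_def)
    ultimately show ?thesis by (intro winning_lost) (auto simp: painter_lost_iff simp del: atLeastAtMost_iff)
  qed
  consider "A = l + 1" | "B = l + 1" | "A \<le> l" "B \<le> l" using less.prems by linarith
  then show ?case
  proof cases
    case 1
    then have "(1, l, g l) \<in> labels A B g h" using l by (simp add: labels_def)
    then show ?thesis using lost by blast
  next
    case 2
    then have "(2, l, h l) \<in> labels A B g h" using l by (simp add: labels_def)
    then show ?thesis using lost by blast
  next
    case 3
    define m where "m = B * three_pow_log2 A"
    have "\<exists>M. \<forall>G col. legal_board ?k G \<and> (\<forall>x\<in>labels (A + 1) B (g(A := m)) h. M \<le> card (stock G col x)) \<longrightarrow> winning l ?k G col"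
    proof (rule less.hyps)
      show "bounded_walk (A + 1) B (g(A := m)) h"
        unfolding m_def by (rule bounded_walk_right[OF less.prems(1,4)])
    qed (use less.prems 3 in linarith)+
    then obtain M1 where M1: "\<And>G col. legal_board ?k G \<Longrightarrow> \<forall>x\<in>labels (A + 1) B (g(A := m)) h. M1 \<le> card (stock G col x) \<Longrightarrow> winning l ?k G col"
      by blast
    have "\<exists>M. \<forall>G col. legal_board ?k G \<and> (\<forall>x\<in>labels A (B + 1) g (h(B := m)). M \<le> card (stock G col x)) \<longrightarrow> winning l ?k G col"
    proof (rule less.hyps)
      show "bounded_walk A (B + 1) g (h(B := m))"
        unfolding m_def by (rule bounded_walk_up[OF less.prems(1,4)])
    qed (use less.prems 3 in linarith)+
    then obtain M2 where M2: "\<And>G col. legal_board ?k G \<Longrightarrow> \<forall>x\<in>labels A (B + 1) g (h(B := m)). M2 \<le> card (stock G col x) \<Longrightarrow> winning l ?k G col"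
      by blast
    obtain a1 a2 b1 b2 where pieces: "a1 + a2 + 1 = A" "b1 + b2 + 1 = B"
      "1 + sum_list (map cost [(1, a1, g a1), (1, a2, g a2), (2, b1, h b1), (2, b2, h b2)]) \<le> m"
      using bounded_walk_pieces[OF less.prems(1,2,4)] unfolding m_def by blast
    have m: "m \<le> ?k" unfolding m_def using 3 three_pow_log2_mono[of A l] by (intro mult_le_mono)
    \<comment> \<open>There are at most \<open>M1 + M2\<close> rounds using four components each,
      and \<open>max M1 M2\<close> of every old label must remain for either continuation.\<close>
    define M where "M = max M1 M2 + 4 * (M1 + M2)"
    have "winning l ?k G col" if G: "legal_board ?k G" "\<forall>x\<in>labels A B g h. M \<le> card (stock G col x)" for G col
    proof (rule repeat_join[OF refl _ pieces(3) m, where M = "max M1 M2" and Lab = "labels A B g h" and ?M1.0 = M1 and ?M2.0 = M2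
            and n = "M1 + M2" and ?Q1.0 = "{}" and ?Q2.0 = "{}"], unfold pieces(1,2))
      fix s a t :: nat
      assume "(s, a, t) \<in> set [(1, a1, g a1), (1, a2, g a2), (2, b1, h b1), (2, b2, h b2)]" "0 < a"
      then show "(s, a, t) \<in> labels A B g h" using pieces(1,2) by (auto simp: labels_def)
    next
      fix G col
      assume board: "legal_board ?k G" and old: "\<forall>x\<in>labels A B g h. max M1 M2 \<le> card (stock G col x)"
        and "M1 \<le> card (stock G col (1, A, m)) \<or> M2 \<le> card (stock G col (2, B, m))"
      then show "winning l ?k G col"
      proof (elim disjE)
        assume new: "M1 \<le> card (stock G col (1, A, m))"
        have sub: "labels (A + 1) B (g(A := m)) h \<subseteq> insert (1, A, m) (labels A B g h)"
          by (auto simp: labels_def)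
        show ?thesis
        proof (rule M1[OF board], rule ballI)
          fix x assume "x \<in> labels (A + 1) B (g(A := m)) h"
          then have "x = (1, A, m) \<or> x \<in> labels A B g h" using sub by blast
          then show "M1 \<le> card (stock G col x)"
          proof
            assume "x \<in> labels A B g h"
            then have "max M1 M2 \<le> card (stock G col x)" using old by blast
            then show ?thesis by simp
          qed (use new in simp)
        qed
      next
        assume new: "M2 \<le> card (stock G col (2, B, m))"
        have sub: "labels A (B + 1) g (h(B := m)) \<subseteq> insert (2, B, m) (labels A B g h)"
          by (auto simp: labels_def)
        show ?thesis
        proof (rule M2[OF board], rule ballI)
          fix x assume "x \<in> labels A (B + 1) g (h(B := m))"
          then have "x = (2, B, m) \<or> x \<in> labels A B g h" using sub by blast
          then show "M2 \<le> card (stock G col x)"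
          proof
            assume "x \<in> labels A B g h"
            then have "max M1 M2 \<le> card (stock G col x)" using old by blast
            then show ?thesis by simp
          qed (use new in simp)
        qed
      qed
    qed (use G in \<open>auto simp: M_def\<close>)
    then show ?thesis by blast
  qed
qed

lemma builder_wins_upper:
  assumes "1 \<le> l"
  shows "builder_wins 2 (\<lambda>_. path_graph l) (l * three_pow_log2 l)"
proof -
  have "bounded_walk 1 1 (\<lambda>_. 0) (\<lambda>_. 0)" by (auto simp: bounded_walk_def)
  then obtain M where M: "\<And>G col. legal_board (l * three_pow_log2 l) G \<Longrightarrow> \<forall>x\<in>labels 1 1 (\<lambda>_. 0) (\<lambda>_. 0). M \<le> card (stock G col x) \<Longrightarrow>
      winning l (l * three_pow_log2 l) G col"
    using builder_walk[OF assms, of 1 1 "\<lambda>_. 0" "\<lambda>_. 0"] assms by (metis le_add2 le_refl)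
  have "\<not> is_cycle ({}, {}) c" for c :: "nat list"
    unfolding is_cycle_def by (intro notI) (force dest: spec[of _ 0])
  then have "winning l (l * three_pow_log2 l) ({}, {}) (\<lambda>_. 0)"
    by (intro M) (auto simp: legal_board_def forest_def simple_graph_def components_def labels_def)
  then show ?thesis by (simp add: winning_def builder_wins_def)
qed

section \<open>Bounds on the game parameter\<close>

lemma three_pow_log2_powr: "1 \<le> x \<Longrightarrow> real (three_pow_log2 x) \<le> real x powr 1.59"
proof (induction x rule: three_pow_log2.induct)
  case (1 x)
  show ?case
  proof (cases "x \<le> 1")
    case True
    then have "x = 1" using 1(2) by simp
    then show ?thesis by (simp add: three_pow_log2.simps[of "Suc 0"])
  next
    case False
    \<comment> \<open>An integer form of \<open>log 2 3 \<le> 1.59\<close>.\<close>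
    have "(3 :: real) ^ 100 \<le> 2 ^ 159" by simp
    then have "(3 powr 100) powr (1 / 100) \<le> ((2 :: real) powr 159) powr (1 / 100)"
      by (intro powr_mono2) (simp_all add: powr_numeral)
    then have 3: "(3 :: real) \<le> 2 powr 1.59" unfolding powr_powr by simp
    have "real (three_pow_log2 x) = 3 * real (three_pow_log2 (x div 2))" using False by (subst three_pow_log2.simps) simp
    also have "\<dots> \<le> 2 powr 1.59 * real (x div 2) powr 1.59"
      using 1 False 3 by (intro mult_mono) auto
    also have "\<dots> = (2 * real (x div 2)) powr 1.59" by (simp add: powr_mult)
    also have "\<dots> \<le> real x powr 1.59"
    proof (rule powr_mono2)
      have "real (2 * (x div 2)) \<le> real x" unfolding of_nat_le_iff by simp
      then show "2 * real (x div 2) \<le> real x" by simp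
    qed simp_all
    finally show ?thesis .
  qed
qed

lemma k_star_upper:
  assumes "1 \<le> l"
  shows "real (k_star_diag (path_graph l) 2) \<le> real l powr 2.59"
proof -
  have "0 < l * three_pow_log2 l" using assms three_pow_log2_pos[of l] by simp
  then have "k_star_diag (path_graph l) 2 \<le> l * three_pow_log2 l"
    unfolding k_star_diag_def k_star_def using builder_wins_upper[OF assms] by (intro Least_le) auto
  then have "real (k_star_diag (path_graph l) 2) \<le> real l * real (three_pow_log2 l)" by (metis of_nat_le_iff of_nat_mult)
  also have "\<dots> \<le> real l powr 1 * real l powr 1.59" using three_pow_log2_powr[OF assms] by (intro mult_mono) auto
  also have "\<dots> = real l powr 2.59" unfolding powr_add[symmetric] by simp
  finally show ?thesis .
qed

text \<open>The upper bound shows that a winning size exists, so Builder wins at the minimum itself;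
  were it below the value of the certificate, Painter would survive there.\<close>

lemma k_star_lower:
  assumes "528 ^ n \<le> l"
  shows "547 ^ (2 * n) \<le> k_star_diag (path_graph l) 2"
proof (rule ccontr)
  let ?k = "k_star_diag (path_graph l) 2"
  assume less: "\<not> 547 ^ (2 * n) \<le> ?k"
  have l: "1 \<le> l" using assms by (metis le_trans one_le_numeral one_le_power)
  obtain g h where gh: "certificate g h" "g (528 ^ n) = 547 ^ (2 * n)" "h (528 ^ n) = 547 ^ (2 * n)"
    using certificate_power by blast
  have "g (528 ^ n) \<le> g l" "h (528 ^ n) \<le> h l"
    using gh(1) assms unfolding certificate_def by (simp_all add: strict_mono_less_eq)
  then have "?k < g l" "?k < h l" using less gh by auto
  then have "\<not> builder_wins 2 (\<lambda>_. path_graph l) ?k" using gh(1) l by (intro painter_survives[of g h]) auto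
  moreover have "0 < l * three_pow_log2 l" using l three_pow_log2_pos[of l] by simp
  then have "builder_wins 2 (\<lambda>_. path_graph l) ?k"
    unfolding k_star_diag_def k_star_def using builder_wins_upper[OF l]
    by (metis (mono_tags, lifting) LeastI)
  ultimately show False by blast
qed

lemma k_star_lower_powr:
  assumes "1 \<le> l"
  shows "real l powr 2.01 \<le> 547\<^sup>2 * real (k_star_diag (path_graph l) 2)"
proof -
  \<comment> \<open>Rounding \<open>l\<close> down to a power of 528 costs the constant factor
    \<open>547 ^ 2\<close>.\<close>
  obtain n where n: "528 ^ n \<le> l" "l < 528 ^ (n + 1)"
    using ex_power_ivl1[of 528 l] assms by auto
  have pow: "(x ^ m) powr a = (x powr a) ^ m" if "0 < x" for x a :: real and m
    using that by (induction m) (auto simp: powr_mult)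
  \<comment> \<open>Hence \<open>528 \<le> 2 ^ 10 \<le> (547 / 528) ^ 200\<close>, whose hundredth
    root gives \<open>528 powr 0.01 \<le> (547 / 528) ^ 2\<close>, the gain over a quadratic
    bound.\<close>
  have two: "(2 :: real) \<le> (547 / 528) powr 20" by (simp add: powr_numeral power_divide)
  have "(528 :: real) \<le> 2 powr 10" by simp
  also have "\<dots> \<le> ((547 / 528) powr 20) powr 10" using two by (intro powr_mono2) auto
  finally have "(528 :: real) powr 0.01 \<le> (((547 / 528) powr 20) powr 10) powr 0.01"
    by (intro powr_mono2) auto
  also have "\<dots> = (547 / 528)\<^sup>2" unfolding powr_powr by (simp add: powr_numeral)
  finally have "528 powr 2 * (528 :: real) powr 0.01 \<le> 528\<^sup>2 * (547 / 528)\<^sup>2"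
    by (simp add: powr_numeral)
  then have base: "(528 :: real) powr 2.01 \<le> 547\<^sup>2"
    unfolding powr_add[symmetric] by (simp add: power_divide)
  have "real l powr 2.01 \<le> real (528 ^ (n + 1)) powr 2.01"
    using n(2) by (intro powr_mono2) (simp_all only: of_nat_le_iff of_nat_0_le_iff less_imp_le, simp)
  also have "\<dots> = (528 powr 2.01) ^ (n + 1)" by (simp only: of_nat_power of_nat_numeral pow)
  also have "\<dots> \<le> (547\<^sup>2) ^ (n + 1)" using base by (intro power_mono) auto
  also have "\<dots> = 547\<^sup>2 * real (547 ^ (2 * n))" by (simp add: power_mult)
  also have "\<dots> \<le> 547\<^sup>2 * real (k_star_diag (path_graph l) 2)"
  proof (rule mult_left_mono)
    show "real (547 ^ (2 * n)) \<le> real (k_star_diag (path_graph l) 2)"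
      unfolding of_nat_le_iff by (rule k_star_lower[OF n(1)])
  qed simp
  finally show ?thesis .
qed

theorem theorem4:
  "(\<lambda>l. real (k_star_diag (path_graph l) 2)) \<in> \<Omega>(\<lambda>l. real l powr 2.01) \<and>
   (\<lambda>l. real (k_star_diag (path_graph l) 2)) \<in> O(\<lambda>l. real l powr 2.59)"
proof
  show "(\<lambda>l. real (k_star_diag (path_graph l) 2)) \<in> \<Omega>(\<lambda>l. real l powr 2.01)"
    using k_star_lower_powr
    by (intro landau_omega.bigI[of "1 / 547\<^sup>2"] eventually_sequentiallyI[of 1]) (auto simp: field_simps)
  show "(\<lambda>l. real (k_star_diag (path_graph l) 2)) \<in> O(\<lambda>l. real l powr 2.59)"
    using k_star_upper by (intro landau_o.bigI[of 1] eventually_sequentiallyI[of 1]) auto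
qed

end
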